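(* Let $(Q,N,C_1,\dots,C_N)$ be a random vector with $N\in\{0,1,2,\dots\}\cup\{\infty\}$ and $Q$, $\{C_i\}$ real valued, and let $R^{(n)}=\sum_{k=0}^nW_k$ and $R=\sum_{k=0}^\infty W_k$ be constructed on the associated weighted branching tree (see context). Write $\rho_\beta=E\left[\sum_{i=1}^N|C_i|^\beta\right]$ and $\rho=\rho_1$. Assume $E[|Q|^\beta]<\infty$ for some $\beta>0$. In addition, suppose either (i) $\rho_\beta<1$ if $0<\beta<1$, or (ii) $(\rho\vee\rho_\beta)<1$ and $E\left[\left(\sum_{i=1}^N|C_i|\right)^\beta\right]<\infty$ if $\beta\ge1$. Then $E[|R|^\gamma]<\infty$ for all $0<\gamma\le\beta$. Moreover, if $\beta\ge1$, $R^{(n)}\stackrel{L_\beta}{\to}R$ as $n\to\infty$, where $L_\beta$ stands for convergence in the $(E|\cdot|^\beta)^{1/\beta}$ norm.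
   Context: Weighted branching tree. Let $U=\bigcup_{k=0}^\infty\{1,2,3,\dots\}^k$ be the set of finite sequences of positive integers, $\emptyset$ the empty sequence, and $(\mathbf{i},j)$ the concatenation of $\mathbf{i}\in U$ with $j$. Let $\{(Q_{\mathbf{i}},N_{\mathbf{i}},C_{(\mathbf{i},1)},\dots,C_{(\mathbf{i},N_{\mathbf{i}})})\}_{\mathbf{i}\in U}$ be iid copies of $(Q,N,C_1,\dots,C_N)$ (whose components may be arbitrarily dependent), the one at $\emptyset$ being $(Q,N,C_1,\dots,C_N)$ itself. Set $A_0=\{\emptyset\}$ and $A_n=\{(\mathbf{i},j):\mathbf{i}\in A_{n-1},\ 1\le j\le N_{\mathbf{i}}\}$ for $n\ge1$ ($j$ a finite integer), and define weights $\Pi_\emptyset=1$, $\Pi_{(\mathbf{i},j)}=C_{(\mathbf{i},j)}\Pi_{\mathbf{i}}$. Let $W_n=\sum_{\mathbf{i}\in A_n}Q_{\mathbf{i}}\Pi_{\mathbf{i}}$, $n\ge0$ (so $W_0=Q$). Throughout this setting $P(Q\ne0)>0$. Sums $\sum_{i=1}^N$ run over all finite integers $1\le i\le N$; $a\vee b=\max(a,b)$. *)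

theory Defs
  imports "HOL-Probability.Probability"
begin

text \<open>
  Nodes are lists of positive integers. The paper's \<open>C_(i,j)\<close> is \<open>C (i @ [j])\<close>, so the
  vector attached to node \<open>i\<close> is \<open>(Q i, N i, C (i @ [1]), C (i @ [2]), ...)\<close> with
  \<open>N i\<close> entries of type \<open>C\<close>.
\<close>

definition nodes :: "nat list set" where
  "nodes = lists {1..}"

definition children :: "(nat list \<Rightarrow> 'a \<Rightarrow> enat) \<Rightarrow> nat list \<Rightarrow> 'a \<Rightarrow> nat set" where
  "children N i \<omega> = {j. 1 \<le> j \<and> enat j \<le> N i \<omega>}"

text \<open>
  A vector \<open>(Q, N, C_1, ..., C_N)\<close> of random length is coded injectively as an element of a fixed
  product space by padding with zeros beyond position \<open>N\<close>. Hence no condition is imposed on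
  \<open>C (i @ [j])\<close> where \<open>j\<close> exceeds \<open>N i\<close>.
\<close>

definition branching_vector ::
  "(nat list \<Rightarrow> 'a \<Rightarrow> real) \<Rightarrow> (nat list \<Rightarrow> 'a \<Rightarrow> enat) \<Rightarrow> (nat list \<Rightarrow> 'a \<Rightarrow> real)
    \<Rightarrow> nat list \<Rightarrow> 'a \<Rightarrow> real \<times> enat \<times> (nat \<Rightarrow> real)" where
  "branching_vector Q N C i \<omega> =
     (Q i \<omega>, N i \<omega>, \<lambda>j. if j \<in> children N i \<omega> then C (i @ [j]) \<omega> else 0)"

definition vector_space_measure :: "(real \<times> enat \<times> (nat \<Rightarrow> real)) measure" where
  "vector_space_measure =
     borel \<Otimes>\<^sub>M (count_space UNIV \<Otimes>\<^sub>M (\<Pi>\<^sub>M j\<in>UNIV. borel))"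

fun generation :: "(nat list \<Rightarrow> 'a \<Rightarrow> enat) \<Rightarrow> nat \<Rightarrow> 'a \<Rightarrow> nat list set" where
  "generation N 0 \<omega> = {[]}"
| "generation N (Suc n) \<omega> = {i @ [j] | i j. i \<in> generation N n \<omega> \<and> j \<in> children N i \<omega>}"

function node_weight :: "(nat list \<Rightarrow> 'a \<Rightarrow> real) \<Rightarrow> nat list \<Rightarrow> 'a \<Rightarrow> real" where
  "node_weight C [] \<omega> = 1"
| "node_weight C (i @ [j]) \<omega> = C (i @ [j]) \<omega> * node_weight C i \<omega>"
  by (auto, metis rev_exhaust)
termination by (relation "Wellfounded.measure (\<lambda>(C, i, \<omega>). length i)") auto

text \<open>
  A generation may be infinite and carries no order, so the sum over it is the unconditional one.
  It is 0 where the family is not summable.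
\<close>

definition W ::
  "(nat list \<Rightarrow> 'a \<Rightarrow> real) \<Rightarrow> (nat list \<Rightarrow> 'a \<Rightarrow> enat) \<Rightarrow> (nat list \<Rightarrow> 'a \<Rightarrow> real)
    \<Rightarrow> nat \<Rightarrow> 'a \<Rightarrow> real" where
  "W Q N C n \<omega> = (\<Sum>\<^sub>\<infinity>i\<in>generation N n \<omega>. Q i \<omega> * node_weight C i \<omega>)"

definition R_partial ::
  "(nat list \<Rightarrow> 'a \<Rightarrow> real) \<Rightarrow> (nat list \<Rightarrow> 'a \<Rightarrow> enat) \<Rightarrow> (nat list \<Rightarrow> 'a \<Rightarrow> real)
    \<Rightarrow> nat \<Rightarrow> 'a \<Rightarrow> real" where
  "R_partial Q N C n \<omega> = (\<Sum>k\<le>n. W Q N C k \<omega>)"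

definition R_total ::
  "(nat list \<Rightarrow> 'a \<Rightarrow> real) \<Rightarrow> (nat list \<Rightarrow> 'a \<Rightarrow> enat) \<Rightarrow> (nat list \<Rightarrow> 'a \<Rightarrow> real)
    \<Rightarrow> 'a \<Rightarrow> real" where
  "R_total Q N C \<omega> = (\<Sum>k. W Q N C k \<omega>)"

definition R_well_defined ::
  "(nat list \<Rightarrow> 'a \<Rightarrow> real) \<Rightarrow> (nat list \<Rightarrow> 'a \<Rightarrow> enat) \<Rightarrow> (nat list \<Rightarrow> 'a \<Rightarrow> real)
    \<Rightarrow> 'a \<Rightarrow> bool" where
  "R_well_defined Q N C \<omega> \<longleftrightarrow>
     (\<forall>n. (\<lambda>i. Q i \<omega> * node_weight C i \<omega>) summable_on generation N n \<omega>) \<and>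
     summable (\<lambda>k. W Q N C k \<omega>)"

text \<open>Only used for positive exponents, for which the value at \<open>\<infinity>\<close> is \<open>\<infinity>\<close>.\<close>

definition ennreal_powr :: "ennreal \<Rightarrow> real \<Rightarrow> ennreal" where
  "ennreal_powr x p = (if x = \<infinity> then \<infinity> else ennreal (enn2real x powr p))"

definition rho ::
  "'a measure \<Rightarrow> (nat list \<Rightarrow> 'a \<Rightarrow> enat) \<Rightarrow> (nat list \<Rightarrow> 'a \<Rightarrow> real) \<Rightarrow> real \<Rightarrow> ennreal" where
  "rho M N C \<beta> =
     (\<integral>\<^sup>+\<omega>. (\<Sum>\<^sub>\<infinity>j\<in>children N [] \<omega>. ennreal (\<bar>C [j] \<omega>\<bar> powr \<beta>)) \<partial>M)"

definition Lp_norm :: "'a measure \<Rightarrow> real \<Rightarrow> ('a \<Rightarrow> real) \<Rightarrow> ennreal" where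
  "Lp_norm M p X = ennreal_powr (\<integral>\<^sup>+\<omega>. ennreal (\<bar>X \<omega>\<bar> powr p) \<partial>M) (1 / p)"

definition in_Lp :: "'a measure \<Rightarrow> real \<Rightarrow> ('a \<Rightarrow> real) \<Rightarrow> bool" where
  "in_Lp M p X \<longleftrightarrow> X \<in> borel_measurable M \<and> Lp_norm M p X < \<infinity>"

definition converges_in_Lp :: "'a measure \<Rightarrow> real \<Rightarrow> (nat \<Rightarrow> 'a \<Rightarrow> real) \<Rightarrow> ('a \<Rightarrow> real) \<Rightarrow> bool" where
  "converges_in_Lp M p X Y \<longleftrightarrow>
     (\<forall>n. in_Lp M p (X n)) \<and> in_Lp M p Y \<and>
     (\<lambda>n. Lp_norm M p (\<lambda>\<omega>. X n \<omega> - Y \<omega>)) \<longlonglongrightarrow> 0"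

end

theory Submission
  imports Defs
begin

text \<open>
  Taking absolute values reduces everything to a tree with nonnegative weights. Let \<open>S\<^sub>n\<close> be
  the sum of \<open>\<bar>Q\<^sub>i \<Pi>\<^sub>i\<bar>\<close> over the generation \<open>n\<close> and \<open>T\<close> the sum of all \<open>S\<^sub>n\<close>. Wherever \<open>T\<close> is
  finite, all sums defining \<open>R\<close> converge absolutely, and \<open>T\<close> dominates \<open>\<bar>R\<bar>\<close>, every partial sum
  and every difference between \<open>R\<close> and a partial sum. So the whole statement follows from
  \<open>E T\<^sup>\<beta> < \<infinity>\<close>: this gives the moments directly and the convergence in \<open>L\<^sub>\<beta>\<close> by dominated
  convergence.

  Conditioning on the root, \<open>S\<^sub>n\<^sub>+\<^sub>1\<close> is the sum of \<open>\<bar>C\<^sub>j\<bar> Y\<^sub>j\<close>, where the \<open>Y\<^sub>j\<close> are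
  copies of \<open>S\<^sub>n\<close>, independent of each other and of the root. For \<open>\<beta> \<le> 1\<close>, subadditivity of the
  power gives \<open>E S\<^sub>n\<^sup>\<beta> \<le> E \<bar>Q\<bar>\<^sup>\<beta> \<rho>\<^sub>\<beta>\<^sup>n\<close> (\<open>moment_le_geometric\<close>), and summing over \<open>n\<close> finishes the
  proof. For \<open>\<beta> > 1\<close>, the power of the sum is separated into its diagonal, which contributes at most
  \<open>c E S\<^sub>n\<^sup>\<beta>\<close> for a factor \<open>c < 1\<close> as close to \<open>\<rho>\<^sub>\<beta>\<close> as desired, and cross terms, whose expectation is
  at most a constant times \<open>E (\<Sum>\<bar>C\<^sub>j\<bar>)\<^sup>\<beta> \<cdot> E S\<^sub>n \<cdot> (1 + E S\<^sub>n\<^sup>\<beta>)\<close>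
  (\<open>moment_recursion\<close>). Since \<open>E S\<^sub>n\<close> decays like \<open>\<rho>\<^sup>n\<close>, this is a contraction with a
  geometrically small perturbation, and \<open>E S\<^sub>n\<^sup>\<beta>\<close> decays geometrically (\<open>moment_geometric\<close>). Jensen's
  inequality with geometric weights then bounds \<open>E T\<^sup>\<beta>\<close> (\<open>nn_integral_powr_suminf_finite\<close>).
\<close>

section \<open>Powers of extended nonnegative reals\<close>

lemma ennreal_powr_top [simp]: "ennreal_powr top p = top"
  by (simp add: ennreal_powr_def)

lemma ennreal_powr_ennreal [simp]: "x \<ge> 0 \<Longrightarrow> ennreal_powr (ennreal x) p = ennreal (x powr p)"
  by (simp add: ennreal_powr_def)

lemma ennreal_powr_0 [simp]: "ennreal_powr 0 p = 0"
  by (simp add: ennreal_powr_def)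

lemma ennreal_powr_1 [simp]: "ennreal_powr x 1 = x"
  by (cases x rule: ennreal_cases) auto

lemma measurable_ennreal_powr [measurable]: "(\<lambda>x. ennreal_powr x p) \<in> borel_measurable borel"
  unfolding ennreal_powr_def by measurable

lemma ennreal_powr_mono:
  assumes "x \<le> y" "p > 0"
  shows "ennreal_powr x p \<le> ennreal_powr y p"
  using assms by (cases x rule: ennreal_cases; cases y rule: ennreal_cases)
    (auto intro!: ennreal_leI powr_mono2 simp: top_unique)

text \<open>
  The convention \<open>0 * \<infinity> = 0\<close> agrees with \<open>0 powr p = 0\<close> and
  \<open>\<infinity> powr p = \<infinity>\<close>, so multiplicativity has no exceptional cases.
\<close>
lemma ennreal_powr_mult:
  assumes "p > 0"
  shows "ennreal_powr (x * y) p = ennreal_powr x p * ennreal_powr y p"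
proof -
  have "ennreal_powr (top * y) p = top * ennreal_powr y p" for y
    using assms by (cases y rule: ennreal_cases; cases "y = 0") (auto simp: ennreal_top_mult)
  from this[of x] this[of y] show ?thesis
    by (cases x rule: ennreal_cases; cases y rule: ennreal_cases)
       (auto simp: ennreal_mult[symmetric] powr_mult mult.commute)
qed

lemma ennreal_powr_add:
  assumes "p > 0" "q > 0"
  shows "ennreal_powr x (p + q) = ennreal_powr x p * ennreal_powr x q"
  using assms by (cases x rule: ennreal_cases) (auto simp: ennreal_mult[symmetric] powr_add)

lemma ennreal_powr_powr: "ennreal_powr (ennreal_powr x p) q = ennreal_powr x (p * q)"
  by (cases x rule: ennreal_cases) (auto simp: powr_powr)

lemma ennreal_powr_le_1_plus:
  assumes "0 < p" "p \<le> q"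
  shows "ennreal_powr x p \<le> 1 + ennreal_powr x q"
proof (cases x rule: ennreal_cases)
  case (real r)
  have "r powr p \<le> 1 + r powr q"
  proof (cases "r \<le> 1")
    case True
    then have "r powr p \<le> 1" using real assms by (simp add: powr_le1)
    then show ?thesis using powr_ge_zero[of r q] by linarith
  next
    case False
    then show ?thesis using powr_mono[of p q r] assms by (simp add: add_increasing)
  qed
  then show ?thesis using real
    by (simp flip: ennreal_1 ennreal_plus add: ennreal_leI)
qed simp

lemma ennreal_powr_eq_top_iff [simp]: "ennreal_powr x p = top \<longleftrightarrow> x = top"
  by (cases x rule: ennreal_cases) auto

lemma le_suminf_ennreal: "f j \<le> (\<Sum>j. f j :: ennreal)"
  using sum_le_suminf[of f "{j}"] by simp

lemma suminf_mono_ennreal: "(\<And>j. f j \<le> g j) \<Longrightarrow> (\<Sum>j. f j :: ennreal) \<le> (\<Sum>j. g j)"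
  by (intro suminf_le) auto

lemma suminf_add_ennreal: "(\<Sum>j. f j + g j :: ennreal) = (\<Sum>j. f j) + (\<Sum>j. g j)"
  by (rule suminf_add[symmetric]) auto

text \<open>
  With \<open>t\<close> the \<open>p\<close>-quasinorm of the sequence, every term is at most \<open>t\<close>, so
  \<open>x\<^sub>j = x\<^sub>j powr p * x\<^sub>j powr (1 - p)\<close> is at most \<open>x\<^sub>j powr p * t powr (1 - p)\<close>, and these
  bounds add up to \<open>t\<close>. Arguing on the whole series avoids a passage to the limit from finite
  sums.
\<close>
lemma ennreal_powr_suminf_le:
  assumes "0 < p" "p \<le> 1"
  shows "ennreal_powr (\<Sum>j. x j) p \<le> (\<Sum>j. ennreal_powr (x j) p)"
proof (cases "p = 1 \<or> (\<Sum>j. ennreal_powr (x j) p) = top")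
  case False
  then have p: "0 < p" "p < 1" using assms by auto
  define t where "t = ennreal_powr (\<Sum>j. ennreal_powr (x j) p) (1 / p)"
  have t: "x j \<le> t" for j
    using ennreal_powr_mono[OF le_suminf_ennreal[of "\<lambda>j. ennreal_powr (x j) p" j], of "1 / p"] p
    by (simp add: ennreal_powr_powr t_def)
  have "x j \<le> ennreal_powr (x j) p * ennreal_powr t (1 - p)" for j
  proof -
    have "x j = ennreal_powr (x j) p * ennreal_powr (x j) (1 - p)"
      using ennreal_powr_add[of p "1 - p" "x j"] p by simp
    also have "\<dots> \<le> ennreal_powr (x j) p * ennreal_powr t (1 - p)"
      using p by (intro mult_left_mono ennreal_powr_mono t) auto
    finally show ?thesis .
  qed
  then have "(\<Sum>j. x j) \<le> (\<Sum>j. ennreal_powr (x j) p * ennreal_powr t (1 - p))"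
    by (rule suminf_mono_ennreal)
  also have "\<dots> = (\<Sum>j. ennreal_powr (x j) p) * ennreal_powr t (1 - p)"
    by simp
  also have "(\<Sum>j. ennreal_powr (x j) p) = ennreal_powr t p"
    using p by (simp add: t_def ennreal_powr_powr)
  also have "ennreal_powr t p * ennreal_powr t (1 - p) = t"
    using ennreal_powr_add[of p "1 - p" t] p by simp
  finally have "ennreal_powr (\<Sum>j. x j) p \<le> ennreal_powr t p"
    by (rule ennreal_powr_mono) fact
  then show ?thesis using p by (simp add: t_def ennreal_powr_powr)
qed auto

text \<open>
  Jensen's inequality for a sub-probability vector \<open>e\<close>: at the mean \<open>m\<close>, Young's inequality
  bounds \<open>y * m powr (p - 1)\<close> by \<open>y powr p / p + (1 - 1 / p) * m powr p\<close>. Averaging over \<open>e\<close> and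
  absorbing the last term gives the claim once \<open>m\<close> is known to be finite.
\<close>
lemma ennreal_powr_suminf_Jensen:
  assumes p: "p > 1" and e: "(\<Sum>j. e j) \<le> 1"
  shows "ennreal_powr (\<Sum>j. e j * y j) p \<le> (\<Sum>j. e j * ennreal_powr (y j) p)"
proof (cases "(\<Sum>j. e j * ennreal_powr (y j) p)" rule: ennreal_cases)
  case (real r)
  \<comment> \<open>The mean must be finite before its power can be absorbed into the left-hand side.\<close>
  have "(\<Sum>j. e j * y j) \<le> (\<Sum>j. e j * (1 + ennreal_powr (y j) p))"
    using ennreal_powr_le_1_plus[of 1 p] p by (intro suminf_mono_ennreal mult_left_mono) auto
  also have "\<dots> = (\<Sum>j. e j) + ennreal r"
    by (simp add: ring_distribs suminf_add_ennreal real)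
  also have "\<dots> < top"
    using e by (simp add: less_top[symmetric]) (metis ennreal_one_neq_top top_unique)
  finally obtain m where m: "(\<Sum>j. e j * y j) = ennreal m" "m \<ge> 0"
    by (metis ennreal_cases less_irrefl)
  have Young: "z * ennreal (m powr (p - 1)) \<le>
      ennreal (1 / p) * ennreal_powr z p + ennreal ((1 - 1 / p) * m powr p)" for z
  proof (cases z rule: ennreal_cases)
    case (real z')
    have "z' * m powr (p - 1) \<le> z' powr p / p + (m powr (p - 1)) powr (p / (p - 1)) / (p / (p - 1))"
      using p real by (intro Youngs_inequality) (auto simp: field_simps)
    also have "\<dots> = 1 / p * z' powr p + (1 - 1 / p) * m powr p"
    proof -
      have "(p - 1) * (p / (p - 1)) = p" "1 / (p / (p - 1)) = 1 - 1 / p"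
        using p by (auto simp: field_simps)
      then show ?thesis
        by (simp only: powr_powr) (metis (no_types, opaque_lifting) divide_inverse mult.commute mult_1)
    qed
    finally show ?thesis
      using real p by (simp flip: ennreal_mult ennreal_plus add: ennreal_leI)
  next
    case top
    with p show ?thesis by (simp add: ennreal_mult_top)
  qed
  have "ennreal (m powr p) = ennreal m * ennreal (m powr (p - 1))"
    using m p by (cases "m = 0") (simp_all flip: ennreal_mult add: powr_diff)
  also have "\<dots> = (\<Sum>j. e j * (y j * ennreal (m powr (p - 1))))"
    using m by (simp flip: m(1) mult.assoc)
  also have "\<dots> \<le> (\<Sum>j. e j * (ennreal (1 / p) * ennreal_powr (y j) p + ennreal ((1 - 1 / p) * m powr p)))"
    by (intro suminf_mono_ennreal mult_left_mono Young) auto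
  also have "\<dots> = ennreal (1 / p) * (\<Sum>j. e j * ennreal_powr (y j) p) +
      (\<Sum>j. e j) * ennreal ((1 - 1 / p) * m powr p)"
    by (simp add: ring_distribs suminf_add_ennreal mult.left_commute[of _ "ennreal (1 / p)"]
          del: ennreal_mult_divide_eq)
  also have "\<dots> \<le> ennreal (1 / p) * ennreal r + 1 * ennreal ((1 - 1 / p) * m powr p)"
    unfolding real by (intro add_mono mult_right_mono e) auto
  also have "\<dots> = ennreal (1 / p * r + (1 - 1 / p) * m powr p)"
    using p real by (simp flip: ennreal_mult ennreal_plus)
  finally have "m powr p \<le> 1 / p * r + (1 - 1 / p) * m powr p"
    using p real by (subst (asm) ennreal_le_iff) auto
  then have "m powr p \<le> r"
    using p by (simp add: field_simps)
  then show ?thesis using m real by (simp add: ennreal_leI)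
qed simp

text \<open>
  The coefficient of \<open>x powr p\<close> can be brought as close to 1 as desired, at the expense of the
  one of \<open>y powr p\<close>: if \<open>y \<le> \<delta> * x\<close> the sum is at most \<open>(1 + \<delta>) * x\<close>, and otherwise it is at most
  \<open>(1 + 1 / \<delta>) * y\<close>. It is what preserves a contraction factor below 1.
\<close>
lemma ennreal_powr_add_le:
  assumes "p > 0" "\<delta> > 0"
  shows "ennreal_powr (x + y) p \<le>
    ennreal ((1 + \<delta>) powr p) * ennreal_powr x p + ennreal ((1 + 1 / \<delta>) powr p) * ennreal_powr y p"
proof -
  have "1 + 1 / \<delta> \<noteq> 0" "1 + \<delta> \<noteq> 0"
    using assms by (auto simp: add_pos_pos less_imp_neq[symmetric] field_simps)
  then have coeff: "ennreal ((1 + \<delta>) powr p) \<noteq> 0" "ennreal ((1 + 1 / \<delta>) powr p) \<noteq> 0"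
    by (auto simp: ennreal_eq_0_iff not_le)
  show ?thesis
  proof (cases x rule: ennreal_cases)
    case x: (real a)
    show ?thesis
    proof (cases y rule: ennreal_cases)
      case y: (real b)
      have "(a + b) powr p \<le> (1 + \<delta>) powr p * a powr p + (1 + 1 / \<delta>) powr p * b powr p"
      proof (cases "b \<le> \<delta> * a")
        case True
        have "(a + b) powr p \<le> ((1 + \<delta>) * a) powr p"
          using True x y assms by (intro powr_mono2) (auto simp: algebra_simps)
        also have "\<dots> = (1 + \<delta>) powr p * a powr p"
          using x assms by (simp add: powr_mult)
        finally show ?thesis using powr_ge_zero[of "1 + 1 / \<delta>" p] powr_ge_zero[of b p]
          by (meson add_increasing2 mult_nonneg_nonneg)
      next
        case False
        have "(a + b) powr p \<le> ((1 + 1 / \<delta>) * b) powr p"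
          using False x y assms by (intro powr_mono2) (auto simp: field_simps)
        also have "\<dots> = (1 + 1 / \<delta>) powr p * b powr p"
          using y assms by (simp add: powr_mult)
        finally show ?thesis by (smt (verit) mult_nonneg_nonneg powr_ge_zero)
      qed
      then show ?thesis
        using x y by (simp flip: ennreal_mult ennreal_plus add: ennreal_leI)
    next
      case top
      then show ?thesis using coeff by (simp add: ennreal_mult_top)
    qed
  next
    case top
    then show ?thesis using coeff by (simp add: ennreal_mult_top)
  qed
qed

section \<open>Generation totals of a deterministic tree\<close>

text \<open>
  The total weight in generation \<open>n\<close> of a tree in which vertex \<open>k\<close> carries the mark \<open>v k\<close>, a
  mark \<open>x\<close> giving a vertex the value \<open>q x\<close> and its \<open>j\<close>-th edge the factor \<open>d j x\<close>. The recursion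
  goes through the subtrees of the root because for iid marks these are independent copies of the
  tree. Every vertex has one child for each natural number; a missing child is an edge of factor 0.
\<close>
fun generation_total :: "('b \<Rightarrow> ennreal) \<Rightarrow> (nat \<Rightarrow> 'b \<Rightarrow> ennreal) \<Rightarrow> nat \<Rightarrow> (nat list \<Rightarrow> 'b) \<Rightarrow> ennreal" where
  "generation_total q d 0 v = q (v [])"
| "generation_total q d (Suc n) v = (\<Sum>j. d j (v []) * generation_total q d n (\<lambda>k. v (j # k)))"

text \<open>
  Path weights grow at the end of a path, whereas generation totals split off its first step.
  The induction therefore moves the vertices of level \<open>n\<close> up one level at a time and collects
  the subtree below each of them. Only an upper bound on finite partial sums is claimed: absolute
  summability and domination follow from it.
\<close>
lemma sum_weights_le_generation_total:
  fixes w :: "nat list \<Rightarrow> ennreal"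
  assumes w: "w [] = 1" "\<And>k j. w (k @ [j]) = w k * d j (v k)"
    and A: "finite A" "A \<subseteq> {k. length k = n}"
  shows "(\<Sum>k\<in>A. w k * q (v k)) \<le> generation_total q d n v"
proof -
  have "(\<Sum>k\<in>A. w k * generation_total q d m (\<lambda>l. v (k @ l))) \<le> generation_total q d (n + m) v"
    if "finite A" "A \<subseteq> {k. length k = n}" for A m n
    using that
  proof (induction n arbitrary: A m)
    case 0
    then have "A \<subseteq> {[]}" by auto
    then have "A = {} \<or> A = {[]}" by blast
    then show ?case using w by auto
  next
    case (Suc n)
    define B where "B = butlast ` A"
    define J where "J = last ` A"
    have fin: "finite B" "finite J" using Suc.prems by (auto simp: B_def J_def)
    have B: "B \<subseteq> {k. length k = n}" using Suc.prems by (auto simp: B_def)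
    have A: "A \<subseteq> (\<lambda>(k, j). k @ [j]) ` (B \<times> J)"
    proof
      fix k assume "k \<in> A"
      moreover from this have "k \<noteq> []" using Suc.prems by auto
      ultimately show "k \<in> (\<lambda>(k, j). k @ [j]) ` (B \<times> J)"
        by (intro image_eqI[of _ _ "(butlast k, last k)"]) (auto simp: B_def J_def)
    qed
    have "(\<Sum>k\<in>A. w k * generation_total q d m (\<lambda>l. v (k @ l))) \<le>
        (\<Sum>k\<in>(\<lambda>(k, j). k @ [j]) ` (B \<times> J). w k * generation_total q d m (\<lambda>l. v (k @ l)))"
      by (intro sum_mono2 finite_imageI finite_cartesian_product fin A) auto
    also have "\<dots> = (\<Sum>(k, j)\<in>B \<times> J. w (k @ [j]) * generation_total q d m (\<lambda>l. v (k @ j # l)))"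
      by (subst sum.reindex) (auto simp: inj_on_def intro!: sum.cong)
    also have "\<dots> = (\<Sum>k\<in>B. w k * (\<Sum>j\<in>J. d j (v k) * generation_total q d m (\<lambda>l. v (k @ j # l))))"
      by (simp add: sum.cartesian_product[symmetric] w sum_distrib_left mult.assoc)
    also have "\<dots> \<le> (\<Sum>k\<in>B. w k * generation_total q d (Suc m) (\<lambda>l. v (k @ l)))"
      using fin by (auto intro!: sum_mono mult_left_mono sum_le_suminf)
    also have "\<dots> \<le> generation_total q d (n + Suc m) v"
      by (rule Suc.IH) (use fin B in auto)
    finally show ?case by simp
  qed
  from this[OF A, of 0] show ?thesis by simp
qed

lemma measurable_generation_total [measurable]:
  assumes [measurable]: "q \<in> borel_measurable B" "\<And>j. d j \<in> borel_measurable B"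
  shows "generation_total q d n \<in> borel_measurable (PiM UNIV (\<lambda>_. B))"
proof (induction n)
  case (Suc n)
  note [measurable] = Suc
  have [measurable]: "(\<lambda>v k. v (j # k)) \<in> PiM UNIV (\<lambda>_. B) \<rightarrow>\<^sub>M PiM UNIV (\<lambda>_. B)" for j :: nat
    by (rule measurable_PiM_single') (auto simp: space_PiM)
  show ?case by simp
qed simp

section \<open>Trees with independent and identically distributed marks\<close>

text \<open>
  The common source of two facts below: the marks in a subtree are again an iid family, and the
  vertices of the tree may be relabelled.
\<close>
lemma (in prob_space) indep_vars_reindex_inj:
  assumes f: "inj_on f I" and indep: "indep_vars M' X (f ` I)"
  shows "indep_vars (\<lambda>i. M' (f i)) (\<lambda>i. X (f i)) I"
  unfolding indep_vars_def2 indep_sets_def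
proof (intro conjI ballI allI impI)
  let ?F = "\<lambda>i. {X i -` A \<inter> space M |A. A \<in> sets (M' i)}"
  have rv: "\<forall>i\<in>f ` I. random_variable (M' i) (X i)" and F: "indep_sets ?F (f ` I)"
    using indep by (auto simp: indep_vars_def2)
  show "random_variable (M' (f i)) (X (f i))" if "i \<in> I" for i
    using rv that by auto
  show "?F (f i) \<subseteq> events" if "i \<in> I" for i
    using F that by (auto simp: indep_sets_def)
  fix J A assume J: "J \<subseteq> I" "J \<noteq> {}" "finite J" and A: "A \<in> Pi J (\<lambda>i. ?F (f i))"
  have inv: "inv_into I f (f j) = j" if "j \<in> J" for j
    using f J that by auto
  have "prob (\<Inter>k\<in>f ` J. A (inv_into I f k)) = (\<Prod>k\<in>f ` J. prob (A (inv_into I f k)))"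
  proof (rule indep_setsD[OF F])
    show "\<forall>k\<in>f ` J. A (inv_into I f k) \<in> ?F k"
      using A inv by (fastforce simp: Pi_iff)
  qed (use J in auto)
  moreover have "inj_on f J" using f J(1) by (rule inj_on_subset)
  ultimately show "prob (\<Inter>j\<in>J. A j) = (\<Prod>j\<in>J. prob (A j))"
    by (simp add: prod.reindex inv)
qed

text \<open>
  The complete tree with iid marks \<open>X\<close>. Taking all lists of natural numbers as vertices, rather
  than lists of positive integers, makes the subtree at any vertex a tree of the same form.
\<close>
locale iid_tree = prob_space M for M :: "'a measure" +
  fixes B :: "'b measure"
    and X :: "nat list \<Rightarrow> 'a \<Rightarrow> 'b"
    and q :: "'b \<Rightarrow> ennreal" and d :: "nat \<Rightarrow> 'b \<Rightarrow> ennreal"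
  assumes indep: "indep_vars (\<lambda>_. B) X UNIV"
    and ident: "\<And>i. distr M B (X i) = distr M B (X [])"
    and q_measurable [measurable]: "q \<in> borel_measurable B"
    and d_measurable [measurable]: "\<And>j. d j \<in> borel_measurable B"
begin

lemma X_measurable [measurable]: "X i \<in> M \<rightarrow>\<^sub>M B"
  using indep by (simp add: indep_vars_def)

definition subtree_total :: "nat \<Rightarrow> nat list \<Rightarrow> 'a \<Rightarrow> ennreal" where
  "subtree_total n i \<omega> = generation_total q d n (\<lambda>k. X (i @ k) \<omega>)"

lemma subtree_total_0: "subtree_total 0 i \<omega> = q (X i \<omega>)"
  and subtree_total_Suc: "subtree_total (Suc n) i \<omega> = (\<Sum>j. d j (X i \<omega>) * subtree_total n (i @ [j]) \<omega>)"
  by (simp_all add: subtree_total_def)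

lemma subtree_total_measurable [measurable]: "subtree_total n i \<in> borel_measurable M"
proof -
  have [measurable]: "(\<lambda>\<omega> k. X (i @ k) \<omega>) \<in> M \<rightarrow>\<^sub>M PiM UNIV (\<lambda>_. B)"
    using measurable_space[OF X_measurable] by (intro measurable_PiM_single') auto
  show ?thesis unfolding subtree_total_def[abs_def] by measurable
qed

text \<open>
  The marks of every subtree have the same joint law, the infinite power of the law of the root
  mark; this transfers all moments from the root to the subtrees.
\<close>
lemma distr_subtree:
  "distr M (PiM UNIV (\<lambda>_. B)) (\<lambda>\<omega> k. X (i @ k) \<omega>) = PiM UNIV (\<lambda>_. distr M B (X []))"
proof -
  have "indep_vars (\<lambda>_. B) X (range ((@) i))"
    by (rule indep_vars_subset[OF indep]) auto
  then have "indep_vars (\<lambda>_. B) (\<lambda>k. X (i @ k)) UNIV"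
    by (rule indep_vars_reindex_inj[rotated]) (auto simp: inj_on_def)
  then have "distr M (PiM UNIV (\<lambda>_. B)) (\<lambda>\<omega>. \<lambda>k\<in>UNIV. X (i @ k) \<omega>) = PiM UNIV (\<lambda>k. distr M B (X (i @ k)))"
    by (subst (asm) indep_vars_iff_distr_eq_PiM') auto
  moreover have "(\<lambda>k. distr M B (X (i @ k))) = (\<lambda>_. distr M B (X []))"
    by (rule ext) (rule ident)
  ultimately show ?thesis by (simp add: restrict_UNIV)
qed

lemma nn_integral_subtree_total:
  assumes [measurable]: "g \<in> borel_measurable borel"
  shows "(\<integral>\<^sup>+\<omega>. g (subtree_total n i \<omega>) \<partial>M) = (\<integral>\<^sup>+\<omega>. g (subtree_total n [] \<omega>) \<partial>M)"
proof -
  have "(\<integral>\<^sup>+\<omega>. g (subtree_total n i \<omega>) \<partial>M) = (\<integral>\<^sup>+v. g (generation_total q d n v) \<partial>PiM UNIV (\<lambda>_. distr M B (X [])))" for i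
  proof -
    have "(\<lambda>\<omega> k. X (i @ k) \<omega>) \<in> M \<rightarrow>\<^sub>M PiM UNIV (\<lambda>_. B)"
      using measurable_space[OF X_measurable] by (intro measurable_PiM_single') auto
    moreover have "(\<lambda>v. g (generation_total q d n v)) \<in> borel_measurable (PiM UNIV (\<lambda>_. B))"
      by (rule measurable_compose[OF measurable_generation_total assms]) measurable
    ultimately have "(\<integral>\<^sup>+v. g (generation_total q d n v) \<partial>distr M (PiM UNIV (\<lambda>_. B)) (\<lambda>\<omega> k. X (i @ k) \<omega>)) =
        (\<integral>\<^sup>+\<omega>. g (generation_total q d n (\<lambda>k. X (i @ k) \<omega>)) \<partial>M)"
      by (intro nn_integral_distr) simp_all
    then show ?thesis
      unfolding subtree_total_def distr_subtree by (rule sym)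
  qed
  from this[of i] this[of "[]"] show ?thesis by (rule trans[OF _ sym])
qed

text \<open>
  The root mark and the subtrees of two different children depend on disjoint sets of vertices.
  Three factors suffice for the moment recursion, because there convexity reduces the power of a
  sum to products in which at most two children occur.
\<close>
lemma nn_integral_root_subtrees:
  assumes "a \<noteq> b"
    and [measurable]: "f \<in> borel_measurable B" "g \<in> borel_measurable borel" "h \<in> borel_measurable borel"
  shows "(\<integral>\<^sup>+\<omega>. f (X [] \<omega>) * (g (subtree_total n [a] \<omega>) * h (subtree_total n [b] \<omega>)) \<partial>M) =
    (\<integral>\<^sup>+\<omega>. f (X [] \<omega>) \<partial>M) * ((\<integral>\<^sup>+\<omega>. g (subtree_total n [] \<omega>) \<partial>M) * (\<integral>\<^sup>+\<omega>. h (subtree_total n [] \<omega>) \<partial>M))"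
proof -
  define K where "K = (\<lambda>i::nat. if i = 0 then {[]} else if i = 1 then range ((#) a) else range ((#) b))"
  define G where "G = (\<lambda>(i::nat) v. if i = 0 then f (v [])
    else if i = 1 then g (generation_total q d n (\<lambda>k. v (a # k))) else h (generation_total q d n (\<lambda>k. v (b # k))))"
  have "indep_vars (\<lambda>i. PiM (K i) (\<lambda>_. B)) (\<lambda>i \<omega>. restrict (\<lambda>k. X k \<omega>) (K i)) {0, 1, 2}"
    by (rule indep_vars_restrict[OF indep]) (use assms(1) in \<open>auto simp: K_def disjoint_family_on_def\<close>)
  then have "indep_vars (\<lambda>_. borel) (\<lambda>i \<omega>. G i (restrict (\<lambda>k. X k \<omega>) (K i))) {0, 1, 2}"
  proof (rule indep_vars_compose2)
    fix i :: nat assume "i \<in> {0, 1, 2}"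
    have shift: "(\<lambda>v k. v (c # k)) \<in> PiM (range ((#) c)) (\<lambda>_. B) \<rightarrow>\<^sub>M PiM UNIV (\<lambda>_. B)" for c :: nat
      by (rule measurable_PiM_single') (auto simp: space_PiM PiE_def Pi_def)
    have subtree: "(\<lambda>v. r (generation_total q d n (\<lambda>k. v (c # k)))) \<in> borel_measurable (PiM (range ((#) c)) (\<lambda>_. B))"
      if "r \<in> borel_measurable borel" for c :: nat and r :: "ennreal \<Rightarrow> ennreal"
      using measurable_compose[OF measurable_compose[OF shift measurable_generation_total] that]
      by measurable
    have root: "(\<lambda>v. f (v [])) \<in> borel_measurable (PiM {[]} (\<lambda>_. B))"
      by measurable
    show "G i \<in> borel_measurable (PiM (K i) (\<lambda>_. B))"
      using subtree[OF assms(3), of a] subtree[OF assms(4), of b] root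
      by (simp add: G_def K_def)
  qed
  then have prod: "(\<integral>\<^sup>+\<omega>. (\<Prod>i\<in>{0, 1, 2}. G i (restrict (\<lambda>k. X k \<omega>) (K i))) \<partial>M) =
      (\<Prod>i\<in>{0, 1, 2}. \<integral>\<^sup>+\<omega>. G i (restrict (\<lambda>k. X k \<omega>) (K i)) \<partial>M)"
    by (intro indep_vars_nn_integral) auto
  have G: "G 0 (restrict (\<lambda>k. X k \<omega>) (K 0)) = f (X [] \<omega>)"
    "G 1 (restrict (\<lambda>k. X k \<omega>) (K 1)) = g (subtree_total n [a] \<omega>)"
    "G 2 (restrict (\<lambda>k. X k \<omega>) (K 2)) = h (subtree_total n [b] \<omega>)" for \<omega>
    by (simp_all add: G_def K_def subtree_total_def)
  have prod3: "(\<Prod>i\<in>{0, 1, 2}. z i) = z 0 * (z 1 * z 2)" for z :: "nat \<Rightarrow> ennreal"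
    by (simp add: numeral_2_eq_2)
  show ?thesis
    using prod[unfolded prod3 G]
    unfolding nn_integral_subtree_total[OF assms(3), of _ "[a]"] nn_integral_subtree_total[OF assms(4), of _ "[b]"] .
qed

lemma nn_integral_root_subtree:
  assumes [measurable]: "f \<in> borel_measurable B" "g \<in> borel_measurable borel"
  shows "(\<integral>\<^sup>+\<omega>. f (X [] \<omega>) * g (subtree_total n [a] \<omega>) \<partial>M) =
    (\<integral>\<^sup>+\<omega>. f (X [] \<omega>) \<partial>M) * (\<integral>\<^sup>+\<omega>. g (subtree_total n [] \<omega>) \<partial>M)"
  using nn_integral_root_subtrees[OF n_not_Suc_n assms, of "\<lambda>_. 1"] by (simp add: emeasure_space_1)

definition offspring_moment :: "real \<Rightarrow> ennreal" where
  "offspring_moment p = (\<integral>\<^sup>+\<omega>. (\<Sum>j. ennreal_powr (d j (X [] \<omega>)) p) \<partial>M)"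

definition moment :: "real \<Rightarrow> nat \<Rightarrow> ennreal" where
  "moment p n = (\<integral>\<^sup>+\<omega>. ennreal_powr (subtree_total n [] \<omega>) p \<partial>M)"

text \<open>
  For exponents up to 1 the power is subadditive, so each generation multiplies the moment by at
  most the offspring moment.
\<close>
lemma moment_le_geometric:
  assumes p: "0 < p" "p \<le> 1"
  shows "moment p n \<le> moment p 0 * offspring_moment p ^ n"
proof (induction n)
  case (Suc n)
  have "ennreal_powr (subtree_total (Suc n) [] \<omega>) p \<le> (\<Sum>j. ennreal_powr (d j (X [] \<omega>)) p * ennreal_powr (subtree_total n [j] \<omega>) p)" for \<omega>
    using ennreal_powr_suminf_le[OF p, of "\<lambda>j. d j (X [] \<omega>) * subtree_total n [j] \<omega>"] p
    by (simp add: subtree_total_Suc ennreal_powr_mult)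
  then have "moment p (Suc n) \<le> (\<integral>\<^sup>+\<omega>. (\<Sum>j. ennreal_powr (d j (X [] \<omega>)) p * ennreal_powr (subtree_total n [j] \<omega>) p) \<partial>M)"
    unfolding moment_def by (intro nn_integral_mono)
  also have "\<dots> = (\<Sum>j. (\<integral>\<^sup>+\<omega>. ennreal_powr (d j (X [] \<omega>)) p * ennreal_powr (subtree_total n [j] \<omega>) p \<partial>M))"
    by (rule nn_integral_suminf) measurable
  also have "\<dots> = (\<Sum>j. (\<integral>\<^sup>+\<omega>. ennreal_powr (d j (X [] \<omega>)) p \<partial>M) * moment p n)"
  proof (rule suminf_cong)
    fix j
    show "(\<integral>\<^sup>+\<omega>. ennreal_powr (d j (X [] \<omega>)) p * ennreal_powr (subtree_total n [j] \<omega>) p \<partial>M) =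
      (\<integral>\<^sup>+\<omega>. ennreal_powr (d j (X [] \<omega>)) p \<partial>M) * moment p n"
      unfolding moment_def
      by (rule nn_integral_root_subtree[where f = "\<lambda>x. ennreal_powr (d j x) p" and g = "\<lambda>x. ennreal_powr x p"])
        measurable
  qed
  also have "\<dots> = offspring_moment p * moment p n"
    unfolding offspring_moment_def by (subst nn_integral_suminf) auto
  also have "\<dots> \<le> offspring_moment p * (moment p 0 * offspring_moment p ^ n)"
    by (intro mult_left_mono Suc) auto
  finally show ?case by (simp add: mult_ac)
qed simp

end

section \<open>Geometric decay of the moments\<close>

lemma suminf_split_term_ennreal: "(\<Sum>j. x j) = x i + (\<Sum>j. if j = i then 0 else x j :: ennreal)"
proof -
  have "(\<Sum>j. x j) = (\<Sum>j. (if j = i then x j else 0) + (if j = i then 0 else x j))"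
    by (rule suminf_cong) simp
  also have "\<dots> = (\<Sum>j. if j = i then x j else 0) + (\<Sum>j. if j = i then 0 else x j)"
    by (rule suminf_add_ennreal)
  also have "(\<Sum>j. if j = i then x j else 0) = x i"
    by (subst suminf_finite[of "{i}"]) auto
  finally show ?thesis .
qed

text \<open>
  The quotient is 0 when \<open>x\<close> is 0 or infinite.
\<close>
lemma ennreal_divide_self_le_1: "x / x \<le> (1 :: ennreal)"
  by (cases "x = 0"; cases "x = top") (auto simp: less_top)

text \<open>
  The inequality that drives the case \<open>\<beta> > 1\<close>. Write \<open>Z = (\<Sum>i. x\<^sub>i)\<close> with \<open>x\<^sub>i = d\<^sub>i * y\<^sub>i\<close>
  and expand one factor of \<open>Z powr \<beta> = (\<Sum>i. x\<^sub>i * Z powr (\<beta> - 1))\<close>. In the \<open>i\<close>-th term split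
  \<open>Z = x\<^sub>i + s\<^sub>i\<close>. The part with \<open>x\<^sub>i\<close> yields the diagonal sum, with a constant close to 1. In the
  other part \<open>s\<^sub>i\<close> is \<open>D\<close> times an average of the \<open>y\<^sub>j\<close> with \<open>j \<noteq> i\<close>, and bounding
  \<open>z powr (\<beta> - 1)\<close> by \<open>1 + z powr \<beta>\<close> before applying Jensen's inequality leaves only terms
  \<open>y\<^sub>i * y\<^sub>j powr \<beta>\<close> with \<open>i \<noteq> j\<close>. For independent \<open>y\<^sub>j\<close> their expectation is the first moment times
  the \<open>\<beta>\<close>-th moment, and the first moment is under control separately. Bounding by
  \<open>1 + z powr \<beta>\<close> treats exponents \<open>\<beta> - 1\<close> below and above 1 alike.
\<close>
lemma ennreal_powr_weighted_sum_le:
  fixes d y :: "nat \<Rightarrow> ennreal" and \<beta> \<delta> :: real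
  defines "D \<equiv> \<Sum>j. d j" and "p \<equiv> \<beta> - 1"
  assumes \<beta>: "\<beta> > 1" and \<delta>: "\<delta> > 0" and D: "D < top"
  shows "ennreal_powr (\<Sum>j. d j * y j) \<beta> \<le>
    ennreal ((1 + \<delta>) powr p) * (\<Sum>j. ennreal_powr (d j) \<beta> * ennreal_powr (y j) \<beta>) +
    ennreal ((1 + 1 / \<delta>) powr p) *
      (\<Sum>i. d i * ennreal_powr D p * y i +
        (\<Sum>j. (if j = i then 0 else d i * ennreal_powr D p * (d j / D)) * (y i * ennreal_powr (y j) \<beta>)))"
proof -
  have p: "p > 0" "p \<le> \<beta>" "\<beta> = 1 + p" using \<beta> by (auto simp: p_def)
  define x where "x j = d j * y j" for j
  define s where "s i = (\<Sum>j. if j = i then 0 else x j)" for i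
  let ?Z = "\<Sum>j. x j"
  have d: "D * (d j / D) = d j" for j
  proof (cases "D = 0")
    case True
    then have "d j = 0" using le_suminf_ennreal[of d j] by (simp add: D_def)
    then show ?thesis by simp
  next
    case False
    then show ?thesis using D
      by (simp add: ennreal_times_divide mult.commute[of D] ennreal_mult_divide_eq less_top)
  qed
  \<comment> \<open>The weights \<open>d\<^sub>j / D\<close> with \<open>j \<noteq> i\<close> add up to at most 1; if \<open>D = 0\<close> all of them are 0.\<close>
  have s_le: "ennreal_powr (s i) p \<le>
      ennreal_powr D p * (1 + (\<Sum>j. (if j = i then 0 else d j / D) * ennreal_powr (y j) \<beta>))" for i
  proof -
    define e where "e j = (if j = i then 0 else d j / D)" for j
    have "(\<Sum>j. e j) \<le> (\<Sum>j. d j / D)"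
      by (intro suminf_mono_ennreal) (simp add: e_def)
    also have "\<dots> = D / D" by (simp add: D_def)
    also have "\<dots> \<le> 1" by (rule ennreal_divide_self_le_1)
    finally have e: "(\<Sum>j. e j) \<le> 1" .
    have "x j = D * (d j / D) * y j" for j
      unfolding d by (simp add: x_def)
    then have "s i = (\<Sum>j. D * (e j * y j))"
      unfolding s_def e_def by (intro suminf_cong) (auto simp: mult.assoc)
    also have "\<dots> = D * (\<Sum>j. e j * y j)" by simp
    finally have "ennreal_powr (s i) p = ennreal_powr D p * ennreal_powr (\<Sum>j. e j * y j) p"
      using p by (simp add: ennreal_powr_mult)
    also have "\<dots> \<le> ennreal_powr D p * (1 + ennreal_powr (\<Sum>j. e j * y j) \<beta>)"
      using p by (intro mult_left_mono ennreal_powr_le_1_plus) auto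
    also have "\<dots> \<le> ennreal_powr D p * (1 + (\<Sum>j. e j * ennreal_powr (y j) \<beta>))"
      using \<beta> e by (intro mult_left_mono add_left_mono ennreal_powr_suminf_Jensen) auto
    finally show ?thesis by (simp add: e_def)
  qed
  have each: "x i * ennreal_powr ?Z p \<le>
      ennreal ((1 + \<delta>) powr p) * (ennreal_powr (d i) \<beta> * ennreal_powr (y i) \<beta>) +
      ennreal ((1 + 1 / \<delta>) powr p) * (d i * ennreal_powr D p * y i +
        (\<Sum>j. (if j = i then 0 else d i * ennreal_powr D p * (d j / D)) * (y i * ennreal_powr (y j) \<beta>)))" for i
  proof -
    have "ennreal_powr ?Z p \<le> ennreal ((1 + \<delta>) powr p) * ennreal_powr (x i) p +
        ennreal ((1 + 1 / \<delta>) powr p) * ennreal_powr (s i) p"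
      unfolding s_def suminf_split_term_ennreal[of x i] using p \<delta> by (intro ennreal_powr_add_le) auto
    also have "\<dots> \<le> ennreal ((1 + \<delta>) powr p) * ennreal_powr (x i) p + ennreal ((1 + 1 / \<delta>) powr p) *
        (ennreal_powr D p * (1 + (\<Sum>j. (if j = i then 0 else d j / D) * ennreal_powr (y j) \<beta>)))"
      by (intro add_left_mono mult_left_mono s_le) auto
    finally have "x i * ennreal_powr ?Z p \<le> x i * (ennreal ((1 + \<delta>) powr p) * ennreal_powr (x i) p +
        ennreal ((1 + 1 / \<delta>) powr p) *
        (ennreal_powr D p * (1 + (\<Sum>j. (if j = i then 0 else d j / D) * ennreal_powr (y j) \<beta>))))"
      by (rule mult_left_mono) simp
    also have "\<dots> = ennreal ((1 + \<delta>) powr p) * (x i * ennreal_powr (x i) p) +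
        ennreal ((1 + 1 / \<delta>) powr p) * (x i * ennreal_powr D p +
          (\<Sum>j. (x i * ennreal_powr D p) * ((if j = i then 0 else d j / D) * ennreal_powr (y j) \<beta>)))"
      by (simp add: ring_distribs mult_ac del: ennreal_suminf_cmult) (simp add: mult_ac flip: ennreal_suminf_cmult)
    also have "x i * ennreal_powr (x i) p = ennreal_powr (d i) \<beta> * ennreal_powr (y i) \<beta>"
      using ennreal_powr_add[of 1 p "x i"] p \<beta> by (simp add: x_def ennreal_powr_mult)
    also have "x i * ennreal_powr D p = d i * ennreal_powr D p * y i"
      by (simp add: x_def mult_ac)
    also have "(\<Sum>j. (d i * ennreal_powr D p * y i) * ((if j = i then 0 else d j / D) * ennreal_powr (y j) \<beta>)) =
      (\<Sum>j. (if j = i then 0 else d i * ennreal_powr D p * (d j / D)) * (y i * ennreal_powr (y j) \<beta>))"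
      by (intro suminf_cong) (simp add: mult_ac)
    finally show ?thesis .
  qed
  have "ennreal_powr ?Z \<beta> = ?Z * ennreal_powr ?Z p"
    using ennreal_powr_add[of 1 p ?Z] p by simp
  also have "\<dots> = (\<Sum>i. x i * ennreal_powr ?Z p)" by simp
  also have "\<dots> \<le> (\<Sum>i. ennreal ((1 + \<delta>) powr p) * (ennreal_powr (d i) \<beta> * ennreal_powr (y i) \<beta>) +
      ennreal ((1 + 1 / \<delta>) powr p) * (d i * ennreal_powr D p * y i +
        (\<Sum>j. (if j = i then 0 else d i * ennreal_powr D p * (d j / D)) * (y i * ennreal_powr (y j) \<beta>))))"
    by (intro suminf_mono_ennreal each)
  finally show ?thesis
    unfolding suminf_add_ennreal ennreal_suminf_cmult x_def by simp
qed

text \<open>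
  After finitely many steps the contraction factor, including its perturbation, is at most some
  \<open>c'\<close> strictly between \<open>c\<close> and 1. From then on the inhomogeneous term decays at rate \<open>\<rho>\<close>, and any
  rate \<open>r\<close> above \<open>c'\<close> that is at least \<open>\<rho>\<close> is inherited; the finitely many initial terms only enlarge the constant.
\<close>
lemma real_perturbed_contraction_geometric:
  fixes a :: "nat \<Rightarrow> real"
  assumes c: "0 \<le> c" "c < 1" and K: "0 \<le> K" and \<rho>: "0 \<le> \<rho>" "\<rho> < 1"
    and a: "\<And>n. 0 \<le> a n" "\<And>n. a (Suc n) \<le> c * a n + K * \<rho> ^ n * (1 + a n)"
  shows "\<exists>C r. 0 \<le> C \<and> 0 < r \<and> r < 1 \<and> (\<forall>n. a n \<le> C * r ^ n)"
proof -
  define c' where "c' = (1 + c) / 2"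
  define r where "r = max ((1 + c') / 2) \<rho>"
  have c': "c < c'" "c' < 1" "0 < c'" using c by (auto simp: c'_def)
  have r: "c' < r" "\<rho> \<le> r" "r < 1" "0 < r" using c' \<rho> by (auto simp: r_def less_max_iff_disj)
  have "(\<lambda>n. K * \<rho> ^ n) \<longlonglongrightarrow> K * 0"
    using \<rho> by (intro tendsto_intros LIMSEQ_power_zero) auto
  then have "\<forall>\<^sub>F n in sequentially. K * \<rho> ^ n < c' - c"
    using c' by (intro order_tendstoD(2)) auto
  then obtain n0 where n0: "\<And>n. n \<ge> n0 \<Longrightarrow> K * \<rho> ^ n < c' - c"
    by (auto simp: eventually_sequentially)
  \<comment> \<open>The first summand closes the induction step beyond \<open>n0\<close>, the second covers the indices up to \<open>n0\<close>.\<close>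
  define C where "C = K / (r - c') + (\<Sum>m\<le>n0. a m / r ^ m)"
  have C: "K / (r - c') \<le> C" "0 \<le> C" "\<And>m. m \<le> n0 \<Longrightarrow> a m / r ^ m \<le> C"
  proof -
    have pos: "0 \<le> K / (r - c')" "\<And>m. 0 \<le> a m / r ^ m" using K r a(1) by auto
    show "K / (r - c') \<le> C" using pos by (simp add: C_def sum_nonneg)
    show "0 \<le> C" using pos by (simp add: C_def sum_nonneg add_nonneg_nonneg)
    show "a m / r ^ m \<le> C" if "m \<le> n0" for m
      using member_le_sum[of m "{..n0}" "\<lambda>m. a m / r ^ m"] pos that by (simp add: C_def)
  qed
  have "a n \<le> C * r ^ n" for n
  proof (induction n)
    case 0
    then show ?case using C(3)[of 0] by simp
  next
    case (Suc n)
    show ?case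
    proof (cases "Suc n \<le> n0")
      case True
      then show ?thesis using C(3)[of "Suc n"] r by (simp add: divide_le_eq del: power_Suc)
    next
      case False
      have "a (Suc n) \<le> (c + K * \<rho> ^ n) * a n + K * \<rho> ^ n"
        using a(2)[of n] by (simp add: algebra_simps)
      also have "\<dots> \<le> c' * (C * r ^ n) + K * r ^ n"
        using n0[of n] False Suc a(1) c' K r \<rho>
        by (intro add_mono mult_mono power_mono mult_left_mono) auto
      also have "\<dots> = (c' * C + K) * r ^ n" by (simp add: algebra_simps)
      also have "\<dots> \<le> (C * r) * r ^ n"
        using C(1) r by (intro mult_right_mono) (auto simp: field_simps)
      finally show ?thesis by simp
    qed
  qed
  then show ?thesis using C r by blast
qed

text \<open>
  Over the extended reals finiteness of all terms is part of the conclusion: it propagates from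
  the initial term.
\<close>
lemma perturbed_contraction_geometric:
  fixes a :: "nat \<Rightarrow> ennreal"
  assumes a0: "a 0 < top" and c: "c < 1" and K: "K < top" and \<rho>: "\<rho> < 1"
    and a: "\<And>n. a (Suc n) \<le> c * a n + K * \<rho> ^ n * (1 + a n)"
  shows "\<exists>C r. 0 \<le> C \<and> 0 < r \<and> r < 1 \<and> (\<forall>n. a n \<le> ennreal (C * r ^ n))"
proof -
  have fin: "a n < top" for n
  proof (induction n)
    case (Suc n)
    have "c < top" "\<rho> < top" using c \<rho> by (auto intro: less_trans)
    with Suc K have "c * a n + K * \<rho> ^ n * (1 + a n) < top"
      by (auto simp: ennreal_mult_less_top power_less_top_ennreal)
    with a[of n] show ?case by (rule le_less_trans)
  qed (rule a0)
  obtain c' K' \<rho>' where c': "c = ennreal c'" "0 \<le> c'" "c' < 1"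
    and K': "K = ennreal K'" "0 \<le> K'" and \<rho>': "\<rho> = ennreal \<rho>'" "0 \<le> \<rho>'" "\<rho>' < 1"
    using c K \<rho> by (cases c rule: ennreal_cases; cases K rule: ennreal_cases; cases \<rho> rule: ennreal_cases) auto
  define a' where "a' n = enn2real (a n)" for n
  have a': "a n = ennreal (a' n)" "0 \<le> a' n" for n
    using fin[of n] by (auto simp: a'_def)
  have "a' (Suc n) \<le> c' * a' n + K' * \<rho>' ^ n * (1 + a' n)" for n
  proof -
    have "ennreal (a' (Suc n)) \<le> ennreal (c' * a' n + K' * \<rho>' ^ n * (1 + a' n))"
      using a[of n] c' K' \<rho>' a'(2)[of n]
      unfolding a' by (simp add: ennreal_power flip: ennreal_mult ennreal_plus ennreal_1)
    then show ?thesis using c' K' \<rho>' a'(2)[of n] by (subst (asm) ennreal_le_iff) auto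
  qed
  from real_perturbed_contraction_geometric[OF c'(2,3) K'(2) \<rho>'(2,3) a'(2) this]
  show ?thesis unfolding a' by (metis ennreal_leI)
qed

text \<open>
  The expectation of the pointwise inequality. The total root weight \<open>D\<close> is almost surely finite,
  independence factorises every term, and the root weights of the cross terms add up to at most
  \<open>D powr \<beta>\<close>.
\<close>
lemma (in iid_tree) moment_recursion:
  assumes \<beta>: "\<beta> > 1" and \<delta>: "\<delta> > 0"
    and fin: "(\<integral>\<^sup>+\<omega>. ennreal_powr (\<Sum>j. d j (X [] \<omega>)) \<beta> \<partial>M) < top"
  shows "moment \<beta> (Suc n) \<le> ennreal ((1 + \<delta>) powr (\<beta> - 1)) * (offspring_moment \<beta> * moment \<beta> n) +
    ennreal ((1 + 1 / \<delta>) powr (\<beta> - 1)) *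
      ((\<integral>\<^sup>+\<omega>. ennreal_powr (\<Sum>j. d j (X [] \<omega>)) \<beta> \<partial>M) * moment 1 n * (1 + moment \<beta> n))"
proof -
  define p where "p = \<beta> - 1"
  define D where "D x = (\<Sum>j. d j x)" for x
  have p: "p > 0" "\<beta> = 1 + p" using \<beta> by (auto simp: p_def)
  have [measurable]: "D \<in> borel_measurable B" unfolding D_def[abs_def] by measurable
  \<comment> \<open>The two kinds of root factor in the cross terms, according to the number of subtrees involved.\<close>
  define g1 where "g1 i x = d i x * ennreal_powr (D x) p" for i x
  define g2 where "g2 i j x = (if j = i then 0 else d i x * ennreal_powr (D x) p * (d j x / D x))" for i j x
  have [measurable]: "g1 i \<in> borel_measurable B" "g2 i j \<in> borel_measurable B" for i j
    unfolding g1_def[abs_def] g2_def[abs_def] by measurable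
  define Y where "Y j \<omega> = subtree_total n [j] \<omega>" for j \<omega>
  have [measurable]: "Y j \<in> borel_measurable M" for j
    unfolding Y_def[abs_def] by measurable
  let ?\<kappa> = "ennreal ((1 + \<delta>) powr p)" and ?K = "ennreal ((1 + 1 / \<delta>) powr p)"
  let ?P = "\<lambda>\<omega>. \<Sum>j. ennreal_powr (d j (X [] \<omega>)) \<beta> * ennreal_powr (Y j \<omega>) \<beta>"
  let ?R = "\<lambda>\<omega>. \<Sum>i. g1 i (X [] \<omega>) * Y i \<omega> + (\<Sum>j. g2 i j (X [] \<omega>) * (Y i \<omega> * ennreal_powr (Y j \<omega>) \<beta>))"
  have "AE \<omega> in M. ennreal_powr (D (X [] \<omega>)) \<beta> \<noteq> top"
    using fin nn_integral_noteq_infinite[of "\<lambda>\<omega>. ennreal_powr (D (X [] \<omega>)) \<beta>" M] by (simp add: D_def less_top)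
  then have "AE \<omega> in M. ennreal_powr (subtree_total (Suc n) [] \<omega>) \<beta> \<le> ?\<kappa> * ?P \<omega> + ?K * ?R \<omega>"
  proof eventually_elim
    fix \<omega> assume "ennreal_powr (D (X [] \<omega>)) \<beta> \<noteq> top"
    then have "D (X [] \<omega>) < top" by (simp add: less_top)
    then show "ennreal_powr (subtree_total (Suc n) [] \<omega>) \<beta> \<le> ?\<kappa> * ?P \<omega> + ?K * ?R \<omega>"
      using ennreal_powr_weighted_sum_le[OF \<beta> \<delta>, of "\<lambda>j. d j (X [] \<omega>)" "\<lambda>j. Y j \<omega>"]
      unfolding subtree_total_Suc Y_def g1_def g2_def D_def p_def append_Nil by simp
  qed
  then have "moment \<beta> (Suc n) \<le> (\<integral>\<^sup>+\<omega>. ?\<kappa> * ?P \<omega> + ?K * ?R \<omega> \<partial>M)"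
    unfolding moment_def by (rule nn_integral_mono_AE)
  also have "\<dots> = ?\<kappa> * (\<integral>\<^sup>+\<omega>. ?P \<omega> \<partial>M) + ?K * (\<integral>\<^sup>+\<omega>. ?R \<omega> \<partial>M)"
    by (simp add: nn_integral_add nn_integral_cmult)
  also have "(\<integral>\<^sup>+\<omega>. ?P \<omega> \<partial>M) = offspring_moment \<beta> * moment \<beta> n"
  proof -
    have "(\<integral>\<^sup>+\<omega>. ?P \<omega> \<partial>M) = (\<Sum>j. \<integral>\<^sup>+\<omega>. ennreal_powr (d j (X [] \<omega>)) \<beta> * ennreal_powr (Y j \<omega>) \<beta> \<partial>M)"
      by (rule nn_integral_suminf) measurable
    also have "\<dots> = (\<Sum>j. (\<integral>\<^sup>+\<omega>. ennreal_powr (d j (X [] \<omega>)) \<beta> \<partial>M) * moment \<beta> n)"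
    proof (rule suminf_cong)
      fix j
      show "(\<integral>\<^sup>+\<omega>. ennreal_powr (d j (X [] \<omega>)) \<beta> * ennreal_powr (Y j \<omega>) \<beta> \<partial>M) =
        (\<integral>\<^sup>+\<omega>. ennreal_powr (d j (X [] \<omega>)) \<beta> \<partial>M) * moment \<beta> n"
        unfolding moment_def Y_def
        by (rule nn_integral_root_subtree[where f = "\<lambda>x. ennreal_powr (d j x) \<beta>" and g = "\<lambda>x. ennreal_powr x \<beta>"])
          measurable
    qed
    also have "\<dots> = offspring_moment \<beta> * moment \<beta> n"
      unfolding offspring_moment_def by (subst nn_integral_suminf) auto
    finally show ?thesis .
  qed
  also have "(\<integral>\<^sup>+\<omega>. ?R \<omega> \<partial>M) \<le> (\<integral>\<^sup>+\<omega>. ennreal_powr (D (X [] \<omega>)) \<beta> \<partial>M) * moment 1 n * (1 + moment \<beta> n)"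
  proof -
    have R1: "(\<integral>\<^sup>+\<omega>. g1 i (X [] \<omega>) * Y i \<omega> \<partial>M) = (\<integral>\<^sup>+\<omega>. g1 i (X [] \<omega>) \<partial>M) * moment 1 n" for i
      unfolding moment_def Y_def ennreal_powr_1
      by (rule nn_integral_root_subtree[where f = "g1 i" and g = "\<lambda>x. x"]) measurable
    have R2: "(\<integral>\<^sup>+\<omega>. g2 i j (X [] \<omega>) * (Y i \<omega> * ennreal_powr (Y j \<omega>) \<beta>) \<partial>M) =
        (\<integral>\<^sup>+\<omega>. g2 i j (X [] \<omega>) \<partial>M) * (moment 1 n * moment \<beta> n)" for i j
    proof (cases "i = j")
      case True
      then show ?thesis by (simp add: g2_def)
    next
      case False
      show ?thesis
        unfolding moment_def Y_def ennreal_powr_1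
        by (rule nn_integral_root_subtrees[OF False, where f = "g2 i j" and g = "\<lambda>x. x"
              and h = "\<lambda>x. ennreal_powr x \<beta>"]) measurable
    qed
    have "(\<integral>\<^sup>+\<omega>. ?R \<omega> \<partial>M) = (\<Sum>i. (\<integral>\<^sup>+\<omega>. g1 i (X [] \<omega>) * Y i \<omega> \<partial>M) +
        (\<Sum>j. \<integral>\<^sup>+\<omega>. g2 i j (X [] \<omega>) * (Y i \<omega> * ennreal_powr (Y j \<omega>) \<beta>) \<partial>M))"
      by (simp add: nn_integral_suminf nn_integral_add)
    also have "\<dots> = (\<Sum>i. \<integral>\<^sup>+\<omega>. g1 i (X [] \<omega>) \<partial>M) * moment 1 n +
        (\<Sum>i. \<Sum>j. \<integral>\<^sup>+\<omega>. g2 i j (X [] \<omega>) \<partial>M) * (moment 1 n * moment \<beta> n)"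
      unfolding R1 R2 by (simp add: suminf_add_ennreal)
    also have "\<dots> = (\<integral>\<^sup>+\<omega>. (\<Sum>i. g1 i (X [] \<omega>)) \<partial>M) * moment 1 n +
        (\<integral>\<^sup>+\<omega>. (\<Sum>i. \<Sum>j. g2 i j (X [] \<omega>)) \<partial>M) * (moment 1 n * moment \<beta> n)"
      by (simp add: nn_integral_suminf)
    also have "\<dots> \<le> (\<integral>\<^sup>+\<omega>. ennreal_powr (D (X [] \<omega>)) \<beta> \<partial>M) * moment 1 n +
        (\<integral>\<^sup>+\<omega>. ennreal_powr (D (X [] \<omega>)) \<beta> \<partial>M) * (moment 1 n * moment \<beta> n)"
    proof (intro add_mono mult_right_mono nn_integral_mono)
      fix \<omega>
      let ?x = "X [] \<omega>"
      have g1: "(\<Sum>i. g1 i ?x) = ennreal_powr (D ?x) \<beta>"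
        using ennreal_powr_add[of 1 p "D ?x"] p by (simp add: g1_def D_def)
      then show "(\<Sum>i. g1 i ?x) \<le> ennreal_powr (D ?x) \<beta>" by simp
      have "(\<Sum>i. \<Sum>j. g2 i j ?x) \<le> (\<Sum>i. \<Sum>j. g1 i ?x * (d j ?x / D ?x))"
        by (intro suminf_mono_ennreal) (simp add: g1_def g2_def)
      also have "\<dots> = (\<Sum>i. g1 i ?x) * (D ?x / D ?x)"
        by (simp add: D_def)
      also have "\<dots> \<le> (\<Sum>i. g1 i ?x) * 1"
        by (intro mult_left_mono ennreal_divide_self_le_1) auto
      finally show "(\<Sum>i. \<Sum>j. g2 i j ?x) \<le> ennreal_powr (D ?x) \<beta>"
        by (simp add: g1)
    qed auto
    also have "\<dots> = (\<integral>\<^sup>+\<omega>. ennreal_powr (D (X [] \<omega>)) \<beta> \<partial>M) * moment 1 n * (1 + moment \<beta> n)"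
      by (simp add: ring_distribs mult_ac)
    finally show ?thesis .
  qed
  finally show ?thesis
    unfolding p_def D_def by (simp add: add_left_mono mult_left_mono)
qed


text \<open>
  In the moment recursion the first moment of the subtrees decays geometrically, since
  the offspring moment of exponent 1 is below 1. Hence the recursion is a contraction with factor
  near the offspring moment of exponent \<open>\<beta>\<close> up to a geometrically small perturbation.
\<close>
lemma (in iid_tree) moment_geometric:
  assumes \<beta>: "\<beta> > 1"
    and q: "moment \<beta> 0 < top"
    and \<rho>: "offspring_moment 1 < 1" "offspring_moment \<beta> < 1"
    and fin: "(\<integral>\<^sup>+\<omega>. ennreal_powr (\<Sum>j. d j (X [] \<omega>)) \<beta> \<partial>M) < top"
  shows "\<exists>C r. 0 \<le> C \<and> 0 < r \<and> r < 1 \<and> (\<forall>n. moment \<beta> n \<le> ennreal (C * r ^ n))"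
proof -
  define ED where "ED = (\<integral>\<^sup>+\<omega>. ennreal_powr (\<Sum>j. d j (X [] \<omega>)) \<beta> \<partial>M)"
  obtain \<rho>' where \<rho>': "offspring_moment \<beta> = ennreal \<rho>'" "0 \<le> \<rho>'" "\<rho>' < 1"
    using \<rho>(2) by (cases "offspring_moment \<beta>" rule: ennreal_cases) auto
  \<comment> \<open>A small \<open>\<delta>\<close> keeps the contraction factor below 1.\<close>
  have "((\<lambda>\<delta>. (1 + \<delta>) powr (\<beta> - 1) * \<rho>') \<longlongrightarrow> (1 + 0) powr (\<beta> - 1) * \<rho>') (at_right 0)"
    by (intro tendsto_intros) auto
  then have "\<forall>\<^sub>F \<delta> in at_right 0. (1 + \<delta>) powr (\<beta> - 1) * \<rho>' < 1"
    using \<rho>' by (intro order_tendstoD(2)) auto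
  moreover have "\<forall>\<^sub>F \<delta> in at_right 0. (0::real) < \<delta>"
    by (rule eventually_at_right_less)
  ultimately have "\<forall>\<^sub>F \<delta> in at_right 0. 0 < \<delta> \<and> (1 + \<delta>) powr (\<beta> - 1) * \<rho>' < 1"
    by eventually_elim simp
  then obtain \<delta> where \<delta>: "0 < \<delta>" "(1 + \<delta>) powr (\<beta> - 1) * \<rho>' < 1"
    using eventually_happens'[OF trivial_limit_at_right_real] by blast
  have "moment 1 0 \<le> (\<integral>\<^sup>+\<omega>. 1 + ennreal_powr (subtree_total 0 [] \<omega>) \<beta> \<partial>M)"
    unfolding moment_def using \<beta> by (intro nn_integral_mono ennreal_powr_le_1_plus) auto
  also have "\<dots> = 1 + moment \<beta> 0"
    by (simp add: nn_integral_add moment_def emeasure_space_1)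
  finally have q1: "moment 1 0 < top"
    using q by (auto intro: le_less_trans)
  let ?K = "ennreal ((1 + 1 / \<delta>) powr (\<beta> - 1)) * (ED * moment 1 0)"
  show ?thesis
  proof (rule perturbed_contraction_geometric)
    show "moment \<beta> 0 < top" by fact
    show "ennreal ((1 + \<delta>) powr (\<beta> - 1)) * offspring_moment \<beta> < 1"
      using \<delta> \<rho>' by (simp flip: ennreal_mult ennreal_1 add: ennreal_lessI)
    show "?K < top" using fin q1 by (simp add: ED_def ennreal_mult_less_top)
    show "offspring_moment 1 < 1" by fact
    fix n
    have "moment \<beta> (Suc n) \<le> ennreal ((1 + \<delta>) powr (\<beta> - 1)) * (offspring_moment \<beta> * moment \<beta> n) +
        ennreal ((1 + 1 / \<delta>) powr (\<beta> - 1)) * (ED * moment 1 n * (1 + moment \<beta> n))"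
      unfolding ED_def by (rule moment_recursion[OF \<beta> \<delta>(1) fin])
    also have "\<dots> \<le> ennreal ((1 + \<delta>) powr (\<beta> - 1)) * (offspring_moment \<beta> * moment \<beta> n) +
        ennreal ((1 + 1 / \<delta>) powr (\<beta> - 1)) *
          (ED * (moment 1 0 * offspring_moment 1 ^ n) * (1 + moment \<beta> n))"
      by (intro add_left_mono mult_left_mono mult_right_mono moment_le_geometric) auto
    finally show "moment \<beta> (Suc n) \<le> ennreal ((1 + \<delta>) powr (\<beta> - 1)) * offspring_moment \<beta> * moment \<beta> n +
        ?K * offspring_moment 1 ^ n * (1 + moment \<beta> n)"
      by (simp add: mult_ac)
  qed
qed

text \<open>
  A substitute for Minkowski's inequality for series. Applying Jensen's inequality with geometric weights of
  ratio \<open>t\<close> costs a factor \<open>t powr (1 - \<beta>)\<close> in each further term; a ratio close enough to 1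
  leaves part of the decay rate \<open>r\<close>.
\<close>
lemma nn_integral_powr_suminf_finite:
  assumes \<beta>: "\<beta> > 1" and C: "0 \<le> C" and r: "0 < r" "r < 1"
    and [measurable]: "\<And>n. f n \<in> borel_measurable M"
    and f: "\<And>n. (\<integral>\<^sup>+\<omega>. ennreal_powr (f n \<omega>) \<beta> \<partial>M) \<le> ennreal (C * r ^ n)"
  shows "(\<integral>\<^sup>+\<omega>. ennreal_powr (\<Sum>n. f n \<omega>) \<beta> \<partial>M) < top"
proof -
  \<comment> \<open>The weights must satisfy \<open>r < t powr (\<beta> - 1)\<close>; here the right-hand side is a power of \<open>r\<close> with exponent below 1.\<close>
  define t where "t = r powr (1 / (2 * \<beta>))"
  have t: "0 < t" "t < 1" using r \<beta> powr_less_mono2[of "1 / (2 * \<beta>)" r 1] by (auto simp: t_def)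
  define e where "e n = (1 - t) * t ^ n" for n
  have e: "0 < e n" for n using t by (simp add: e_def)
  define s where "s = r * t powr (1 - \<beta>)"
  have "s = r powr (1 + 1 / (2 * \<beta>) * (1 - \<beta>))"
    using r unfolding s_def t_def by (subst powr_add) (simp add: powr_powr)
  also have "1 + 1 / (2 * \<beta>) * (1 - \<beta>) = (1 + \<beta>) / (2 * \<beta>)"
    using \<beta> by (simp add: field_simps)
  finally have s: "0 < s" "s < 1"
    using r \<beta> powr_less_mono2[of "(1 + \<beta>) / (2 * \<beta>)" r 1] by auto
  have sum_e: "(\<Sum>n. ennreal (e n)) = 1"
  proof -
    have "e sums ((1 - t) * (1 / (1 - t)))"
      unfolding e_def using t by (intro sums_mult geometric_sums) auto
    then show ?thesis using t e by (subst suminf_ennreal_eq[of e 1]) (auto intro: less_imp_le)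
  qed
  have "ennreal_powr (\<Sum>n. f n \<omega>) \<beta> \<le> (\<Sum>n. ennreal (e n powr (1 - \<beta>)) * ennreal_powr (f n \<omega>) \<beta>)" for \<omega>
  proof -
    have "ennreal_powr (\<Sum>n. f n \<omega>) \<beta> = ennreal_powr (\<Sum>n. ennreal (e n) * (ennreal (1 / e n) * f n \<omega>)) \<beta>"
      using e by (simp add: less_imp_le less_imp_neq[symmetric] flip: mult.assoc ennreal_mult)
    also have "\<dots> \<le> (\<Sum>n. ennreal (e n) * ennreal_powr (ennreal (1 / e n) * f n \<omega>) \<beta>)"
      using \<beta> sum_e by (intro ennreal_powr_suminf_Jensen) auto
    also have "\<dots> = (\<Sum>n. ennreal (e n powr (1 - \<beta>)) * ennreal_powr (f n \<omega>) \<beta>)"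
    proof (rule suminf_cong)
      fix n
      have "e n * (1 / e n) powr \<beta> = e n powr (1 - \<beta>)"
        using e[of n] by (simp add: powr_divide powr_diff)
      then show "ennreal (e n) * ennreal_powr (ennreal (1 / e n) * f n \<omega>) \<beta> =
          ennreal (e n powr (1 - \<beta>)) * ennreal_powr (f n \<omega>) \<beta>"
        using e[of n] \<beta> by (simp add: ennreal_powr_mult less_imp_le flip: mult.assoc ennreal_mult)
    qed
    finally show ?thesis .
  qed
  then have "(\<integral>\<^sup>+\<omega>. ennreal_powr (\<Sum>n. f n \<omega>) \<beta> \<partial>M) \<le>
      (\<integral>\<^sup>+\<omega>. (\<Sum>n. ennreal (e n powr (1 - \<beta>)) * ennreal_powr (f n \<omega>) \<beta>) \<partial>M)"
    by (intro nn_integral_mono)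
  also have "\<dots> = (\<Sum>n. ennreal (e n powr (1 - \<beta>)) * (\<integral>\<^sup>+\<omega>. ennreal_powr (f n \<omega>) \<beta> \<partial>M))"
    by (simp add: nn_integral_suminf nn_integral_cmult)
  also have "\<dots> \<le> (\<Sum>n. ennreal (e n powr (1 - \<beta>)) * ennreal (C * r ^ n))"
    by (intro suminf_mono_ennreal mult_left_mono f) auto
  also have "\<dots> = (\<Sum>n. ennreal ((1 - t) powr (1 - \<beta>) * C * s ^ n))"
  proof (rule suminf_cong)
    fix n
    have "(t ^ n) powr (1 - \<beta>) = (t powr (1 - \<beta>)) ^ n"
      using t by (simp add: powr_realpow[symmetric] powr_powr mult.commute)
    then have eq: "e n powr (1 - \<beta>) * (C * r ^ n) = (1 - t) powr (1 - \<beta>) * C * s ^ n"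
      using t by (simp add: e_def s_def powr_mult power_mult_distrib)
    show "ennreal (e n powr (1 - \<beta>)) * ennreal (C * r ^ n) = ennreal ((1 - t) powr (1 - \<beta>) * C * s ^ n)"
      unfolding eq[symmetric] using C r by (intro ennreal_mult[symmetric]) auto
  qed
  also have "\<dots> < top"
    using C s by (subst less_top[symmetric], intro ennreal_suminf_neq_top summable_mult summable_geometric) auto
  finally show ?thesis .
qed

text \<open>
  Up to exponent 1 subadditivity of the power suffices; above 1 it is replaced by the decay of
  the moments together with the geometric-weights bound.
\<close>
lemma (in iid_tree) total_moment_finite:
  assumes "\<beta> > 0" and q: "moment \<beta> 0 < top" and \<rho>: "offspring_moment \<beta> < 1"
    and large: "\<beta> > 1 \<Longrightarrow> offspring_moment 1 < 1 \<and>
      (\<integral>\<^sup>+\<omega>. ennreal_powr (\<Sum>j. d j (X [] \<omega>)) \<beta> \<partial>M) < top"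
  shows "(\<integral>\<^sup>+\<omega>. ennreal_powr (\<Sum>n. subtree_total n [] \<omega>) \<beta> \<partial>M) < top"
proof (cases "\<beta> \<le> 1")
  case True
  have "(\<integral>\<^sup>+\<omega>. ennreal_powr (\<Sum>n. subtree_total n [] \<omega>) \<beta> \<partial>M) \<le> (\<integral>\<^sup>+\<omega>. (\<Sum>n. ennreal_powr (subtree_total n [] \<omega>) \<beta>) \<partial>M)"
    using assms(1) True by (intro nn_integral_mono ennreal_powr_suminf_le)
  also have "\<dots> = (\<Sum>n. moment \<beta> n)"
    unfolding moment_def by (rule nn_integral_suminf) measurable
  also have "\<dots> \<le> (\<Sum>n. moment \<beta> 0 * offspring_moment \<beta> ^ n)"
    using assms(1) True by (intro suminf_mono_ennreal moment_le_geometric)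
  also have "\<dots> = moment \<beta> 0 * (\<Sum>n. offspring_moment \<beta> ^ n)" by simp
  also have "\<dots> < top"
  proof -
    obtain \<rho>' where \<rho>': "offspring_moment \<beta> = ennreal \<rho>'" "0 \<le> \<rho>'" "\<rho>' < 1"
      using \<rho> by (cases "offspring_moment \<beta>" rule: ennreal_cases) auto
    then have "summable (\<lambda>n. \<rho>' ^ n)" by (intro summable_geometric) auto
    then have "(\<Sum>n. ennreal (\<rho>' ^ n)) \<noteq> top"
      by (rule ennreal_suminf_neq_top) (simp add: \<rho>'(2))
    then have "(\<Sum>n. offspring_moment \<beta> ^ n) \<noteq> top"
      using \<rho>'(2) by (simp add: \<rho>'(1) ennreal_power)
    then show ?thesis using q by (simp add: ennreal_mult_less_top less_top)
  qed
  finally show ?thesis .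
next
  case False
  then have "\<beta> > 1" by simp
  with moment_geometric[OF this q _ \<rho>] large obtain C r where
    "0 \<le> C" "0 < r" "r < 1" "\<And>n. moment \<beta> n \<le> ennreal (C * r ^ n)"
    by blast
  with \<open>\<beta> > 1\<close> show ?thesis
    unfolding moment_def by (intro nn_integral_powr_suminf_finite) auto
qed

section \<open>Unconditional sums and limits\<close>

text \<open>
  An unconditional sum written with operations that preserve measurability. The case distinction
  reproduces the value 0 where the series does not converge absolutely.
\<close>
lemma infsum_nat_real: "(\<Sum>\<^sub>\<infinity>n. h n) = (if (\<Sum>n. ennreal \<bar>h n\<bar>) < top then \<Sum>n. h n else 0)"
  for h :: "nat \<Rightarrow> real"
proof (cases "summable (\<lambda>n. \<bar>h n\<bar>)")
  case True
  then have "h summable_on UNIV" by (intro norm_summable_imp_summable_on) simp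
  then have "(\<Sum>\<^sub>\<infinity>n. h n) = (\<Sum>n. h n)"
    by (intro sums_unique has_sum_imp_sums has_sum_infsum)
  moreover have "(\<Sum>n. ennreal \<bar>h n\<bar>) < top"
    using True by (simp add: less_top[symmetric] ennreal_suminf_neq_top)
  ultimately show ?thesis by simp
next
  case False
  then have "\<not> (\<lambda>n. \<bar>h n\<bar>) summable_on UNIV"
    by (subst summable_on_UNIV_nonneg_real_iff) auto
  then have "\<not> h summable_on UNIV"
    unfolding summable_on_iff_abs_summable_on_real[of h] real_norm_def .
  moreover have "(\<Sum>n. ennreal \<bar>h n\<bar>) = top"
    using False by (intro summable_iff_suminf_neq_top) auto
  ultimately show ?thesis by (simp add: infsum_not_exists)
qed

lemma borel_measurable_infsum_countable:
  fixes f :: "'i::countable \<Rightarrow> 'a \<Rightarrow> real"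
  assumes [measurable]: "\<And>i. f i \<in> borel_measurable M"
  shows "(\<lambda>\<omega>. \<Sum>\<^sub>\<infinity>i. f i \<omega>) \<in> borel_measurable M"
proof -
  define h where "h n \<omega> = (if n \<in> range (to_nat :: 'i \<Rightarrow> nat) then f (from_nat n) \<omega> else 0)" for n \<omega>
  have [measurable]: "h n \<in> borel_measurable M" for n
    by (cases "n \<in> range (to_nat :: 'i \<Rightarrow> nat)") (auto simp: h_def[abs_def])
  have "(\<Sum>\<^sub>\<infinity>i. f i \<omega>) = (\<Sum>\<^sub>\<infinity>n. h n \<omega>)" for \<omega>
  proof -
    have "(\<Sum>\<^sub>\<infinity>n. h n \<omega>) = (\<Sum>\<^sub>\<infinity>n\<in>range (to_nat :: 'i \<Rightarrow> nat). f (from_nat n) \<omega>)"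
      by (intro infsum_cong_neutral) (auto simp: h_def)
    also have "\<dots> = (\<Sum>\<^sub>\<infinity>i. f i \<omega>)"
      by (subst infsum_reindex) (auto simp: comp_def)
    finally show ?thesis by simp
  qed
  then show ?thesis unfolding infsum_nat_real by simp
qed

lemma infsum_ennreal_Suc_suminf:
  fixes f :: "nat \<Rightarrow> ennreal"
  assumes "0 \<notin> A"
  shows "(\<Sum>\<^sub>\<infinity>j\<in>A. f j) = (\<Sum>j. if Suc j \<in> A then f (Suc j) else 0)"
proof -
  have A: "A = Suc ` (Suc -` A)"
    using assms by (auto simp: image_iff) (metis not0_implies_Suc)
  have "(\<Sum>\<^sub>\<infinity>j\<in>A. f j) = (\<Sum>\<^sub>\<infinity>j\<in>Suc -` A. f (Suc j))"
    by (subst A, subst infsum_reindex) (auto simp: comp_def)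
  also have "\<dots> = (\<Sum>\<^sub>\<infinity>j. if Suc j \<in> A then f (Suc j) else 0)"
    by (intro infsum_cong_neutral) auto
  also have "\<dots> = (\<Sum>j. if Suc j \<in> A then f (Suc j) else 0)"
    by (intro sums_unique has_sum_imp_sums has_sum_infsum nonneg_summable_on_complete) simp
  finally show ?thesis .
qed

lemma tendsto_ennreal_powr_0:
  fixes x :: "'i \<Rightarrow> ennreal"
  assumes "(x \<longlongrightarrow> 0) F" "p > 0"
  shows "((\<lambda>n. ennreal_powr (x n) p) \<longlongrightarrow> 0) F"
proof -
  have "((\<lambda>n. enn2real (x n)) \<longlongrightarrow> 0) F"
    using assms(1) by (intro tendsto_enn2real) auto
  then have "((\<lambda>n. enn2real (x n) powr p) \<longlongrightarrow> 0 powr p) F"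
    using assms(2) by (intro tendsto_powr') (auto intro!: always_eventually)
  then have "((\<lambda>n. ennreal (enn2real (x n) powr p)) \<longlongrightarrow> ennreal 0) F"
    by (intro tendsto_ennrealI) simp
  moreover have "\<forall>\<^sub>F n in F. x n < top"
    using assms(1) by (rule order_tendstoD(2)) simp
  then have "\<forall>\<^sub>F n in F. ennreal (enn2real (x n) powr p) = ennreal_powr (x n) p"
    by eventually_elim (simp add: ennreal_powr_def)
  ultimately show ?thesis
    by (subst (asm) tendsto_cong) auto
qed

section \<open>Weights in the branching tree\<close>

definition branch_factor ::
  "(nat list \<Rightarrow> 'a \<Rightarrow> enat) \<Rightarrow> (nat list \<Rightarrow> 'a \<Rightarrow> real) \<Rightarrow> nat list \<Rightarrow> nat \<Rightarrow> 'a \<Rightarrow> real" where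
  "branch_factor N C i j \<omega> = (if j \<in> children N i \<omega> then C (i @ [j]) \<omega> else 0)"

text \<open>
  Setting the weight to 0 outside the random tree turns a sum over the random set of vertices of
  a generation into one over a fixed countable set, and makes the weight measurable: beyond the
  last child the edge factors are arbitrary functions.
\<close>
definition path_weight ::
  "(nat list \<Rightarrow> 'a \<Rightarrow> enat) \<Rightarrow> (nat list \<Rightarrow> 'a \<Rightarrow> real) \<Rightarrow> nat list \<Rightarrow> 'a \<Rightarrow> real" where
  "path_weight N C i \<omega> = (if i \<in> generation N (length i) \<omega> then node_weight C i \<omega> else 0)"

lemma generation_length: "i \<in> generation N n \<omega> \<Longrightarrow> length i = n"
  by (induction n arbitrary: i) auto

lemma generation_nodes: "i \<in> generation N n \<omega> \<Longrightarrow> i \<in> nodes"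
proof (induction n arbitrary: i)
  case (Suc n)
  then obtain k j where "i = k @ [j]" "k \<in> generation N n \<omega>" "j \<in> children N k \<omega>"
    by auto
  with Suc.IH[of k] show ?case by (simp add: nodes_def children_def)
qed (simp add: nodes_def)

lemma path_weight_Nil: "path_weight N C [] \<omega> = 1"
  by (simp add: path_weight_def)

lemma path_weight_snoc:
  "path_weight N C (i @ [j]) \<omega> = path_weight N C i \<omega> * branch_factor N C i j \<omega>"
  by (auto simp: path_weight_def branch_factor_def)

lemma path_weight_not_node: "i \<notin> nodes \<Longrightarrow> path_weight N C i \<omega> = 0"
  by (auto simp: path_weight_def dest: generation_nodes)

lemma weighted_term_path_weight:
  "(if length i = n then Q i \<omega> * path_weight N C i \<omega> else 0) =
    (if i \<in> generation N n \<omega> then Q i \<omega> * node_weight C i \<omega> else 0)"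
  using generation_length[of i N n \<omega>] by (auto simp: path_weight_def)

lemma W_eq_infsum_path_weight:
  "W Q N C n \<omega> = (\<Sum>\<^sub>\<infinity>i. if length i = n then Q i \<omega> * path_weight N C i \<omega> else 0)"
  unfolding W_def weighted_term_path_weight by (rule infsum_cong_neutral) auto

lemma summable_on_generation_iff:
  "(\<lambda>i. Q i \<omega> * node_weight C i \<omega>) summable_on generation N n \<omega> \<longleftrightarrow>
    (\<lambda>i. if length i = n then Q i \<omega> * path_weight N C i \<omega> else 0) summable_on UNIV"
  unfolding weighted_term_path_weight by (rule summable_on_cong_neutral) auto

lemma abs_infsum_le:
  fixes f :: "'i \<Rightarrow> real"
  assumes "\<And>A. finite A \<Longrightarrow> (\<Sum>i\<in>A. \<bar>f i\<bar>) \<le> b"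
  shows "f summable_on UNIV" "\<bar>\<Sum>\<^sub>\<infinity>i. f i\<bar> \<le> b"
proof -
  have abs: "(\<lambda>i. norm (f i)) summable_on UNIV"
    unfolding Infinite_Sum.abs_summable_iff_bdd_above using assms by (intro bdd_aboveI2[of _ _ b]) auto
  then show "f summable_on UNIV" by (rule Infinite_Sum.abs_summable_summable)
  show "\<bar>\<Sum>\<^sub>\<infinity>i. f i\<bar> \<le> b"
    using norm_infsum_bound[OF abs] infsum_le_finite_sums[OF abs, of b] assms by simp
qed

section \<open>Moments and convergence of the total\<close>

theorem lemma4p5:
  fixes M :: "'a measure"
    and Q :: "nat list \<Rightarrow> 'a \<Rightarrow> real"
    and N :: "nat list \<Rightarrow> 'a \<Rightarrow> enat"
    and C :: "nat list \<Rightarrow> 'a \<Rightarrow> real"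
    and \<beta> :: real
  assumes "prob_space M"
    and independent:
      "prob_space.indep_vars M (\<lambda>_. vector_space_measure) (branching_vector Q N C) nodes"
    and identically_distributed:
      "\<And>i. i \<in> nodes \<Longrightarrow>
         distr M vector_space_measure (branching_vector Q N C i) =
         distr M vector_space_measure (branching_vector Q N C [])"
    and Q_nonzero: "measure M {\<omega> \<in> space M. Q [] \<omega> \<noteq> 0} > 0"
    and beta_pos: "\<beta> > 0"
    and Q_moment: "integrable M (\<lambda>\<omega>. \<bar>Q [] \<omega>\<bar> powr \<beta>)"
    and contraction:
      "(\<beta> < 1 \<and> rho M N C \<beta> < 1) \<or>
       (\<beta> \<ge> 1 \<and> max (rho M N C 1) (rho M N C \<beta>) < 1 \<and>
        (\<integral>\<^sup>+\<omega>. ennreal_powr (\<Sum>\<^sub>\<infinity>j\<in>children N [] \<omega>. ennreal \<bar>C [j] \<omega>\<bar>) \<beta> \<partial>M) < \<infinity>)"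
  shows "(AE \<omega> in M. R_well_defined Q N C \<omega>) \<and>
         (\<forall>\<gamma>. 0 < \<gamma> \<and> \<gamma> \<le> \<beta> \<longrightarrow> integrable M (\<lambda>\<omega>. \<bar>R_total Q N C \<omega>\<bar> powr \<gamma>)) \<and>
         (\<beta> \<ge> 1 \<longrightarrow> converges_in_Lp M \<beta> (R_partial Q N C) (R_total Q N C))"
proof -
  interpret prob_space M by fact
  \<comment> \<open>Vertices of the complete tree are mapped to nodes by adding 1 to each entry.\<close>
  let ?V = "branching_vector Q N C"
  define X where "X k = ?V (map Suc k)" for k
  define q where "q x = ennreal \<bar>fst x\<bar>" for x :: "real \<times> enat \<times> (nat \<Rightarrow> real)"
  define d where "d j x = ennreal \<bar>snd (snd x) (Suc j)\<bar>" for j and x :: "real \<times> enat \<times> (nat \<Rightarrow> real)"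
  have node: "map Suc k \<in> nodes" for k by (auto simp: nodes_def)
  have V_measurable: "?V i \<in> M \<rightarrow>\<^sub>M vector_space_measure" if "i \<in> nodes" for i
    using independent that by (simp add: indep_vars_def)
  interpret tree: iid_tree M vector_space_measure X q d
  proof unfold_locales
    have "indep_vars (\<lambda>_. vector_space_measure) ?V (range (map Suc))"
      by (rule indep_vars_subset[OF independent]) (use node in auto)
    then show "indep_vars (\<lambda>_. vector_space_measure) X UNIV"
      unfolding X_def[abs_def] by (rule indep_vars_reindex_inj[rotated]) (auto simp: inj_map)
    show "distr M vector_space_measure (X i) = distr M vector_space_measure (X [])" for i
      using identically_distributed[OF node] by (simp add: X_def)
    show "q \<in> borel_measurable vector_space_measure"
      unfolding q_def[abs_def] vector_space_measure_def by measurable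
    show "d j \<in> borel_measurable vector_space_measure" for j
      unfolding d_def[abs_def] vector_space_measure_def by measurable
  qed
  have q_X: "q (X k \<omega>) = ennreal \<bar>Q (map Suc k) \<omega>\<bar>" for k \<omega>
    by (simp add: q_def X_def branching_vector_def)
  have d_X: "d j (X k \<omega>) = ennreal \<bar>branch_factor N C (map Suc k) (Suc j) \<omega>\<bar>" for j k \<omega>
    by (simp add: d_def X_def branching_vector_def branch_factor_def)

  have Q_measurable: "Q i \<in> borel_measurable M" if "i \<in> nodes" for i
  proof -
    have "(\<lambda>\<omega>. fst (?V i \<omega>)) \<in> borel_measurable M"
      using V_measurable[OF that] unfolding vector_space_measure_def by measurable
    then show ?thesis by (simp add: branching_vector_def)
  qed
  have factor_measurable: "branch_factor N C i j \<in> borel_measurable M" if "i \<in> nodes" for i j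
  proof -
    have "(\<lambda>\<omega>. snd (snd (?V i \<omega>)) j) \<in> borel_measurable M"
      using V_measurable[OF that] unfolding vector_space_measure_def by measurable
    then show ?thesis by (simp add: branching_vector_def branch_factor_def[abs_def])
  qed
  have weight_measurable: "path_weight N C i \<in> borel_measurable M" for i
  proof (induction i rule: rev_induct)
    case (snoc j i)
    show ?case
    proof (cases "i \<in> nodes")
      case True
      then show ?thesis
        using snoc factor_measurable[of i j] by (simp add: path_weight_snoc[abs_def])
    next
      case False
      then show ?thesis by (simp add: path_weight_snoc[abs_def] path_weight_not_node)
    qed
  qed (simp add: path_weight_Nil[abs_def])
  have [measurable]: "W Q N C n \<in> borel_measurable M" for n
  proof -
    have "(\<lambda>\<omega>. Q i \<omega> * path_weight N C i \<omega>) \<in> borel_measurable M" for i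
      using Q_measurable[of i] weight_measurable[of i]
      by (cases "i \<in> nodes") (auto simp: path_weight_not_node)
    then show ?thesis
      unfolding W_eq_infsum_path_weight[abs_def] by (intro borel_measurable_infsum_countable) auto
  qed
  have [measurable]: "R_total Q N C \<in> borel_measurable M" "R_partial Q N C n \<in> borel_measurable M" for n
    unfolding R_total_def[abs_def] R_partial_def[abs_def] by measurable

  define T where "T \<omega> = (\<Sum>n. tree.subtree_total n [] \<omega>)" for \<omega>
  have [measurable]: "T \<in> borel_measurable M" unfolding T_def[abs_def] by measurable
  have offspring: "tree.offspring_moment p = rho M N C p" if "p > 0" for p
    unfolding tree.offspring_moment_def rho_def d_X using that
    by (subst infsum_ennreal_Suc_suminf)
       (auto simp: children_def branch_factor_def intro!: nn_integral_cong suminf_cong)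
  have T_moment: "(\<integral>\<^sup>+\<omega>. ennreal_powr (T \<omega>) \<beta> \<partial>M) < top"
    unfolding T_def
  proof (rule tree.total_moment_finite)
    show "\<beta> > 0" by fact
    show "tree.moment \<beta> 0 < top"
      using Q_moment by (simp add: tree.moment_def tree.subtree_total_0 q_X integrable_iff_bounded)
    show "tree.offspring_moment \<beta> < 1"
      using contraction beta_pos by (auto simp: offspring)
    assume "\<beta> > 1"
    have "(\<Sum>j. d j (X [] \<omega>)) = (\<Sum>\<^sub>\<infinity>j\<in>children N [] \<omega>. ennreal \<bar>C [j] \<omega>\<bar>)" for \<omega>
      unfolding d_X
      by (subst infsum_ennreal_Suc_suminf) (auto simp: children_def branch_factor_def intro!: suminf_cong)
    with \<open>\<beta> > 1\<close> contraction show "tree.offspring_moment 1 < 1 \<and>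
        (\<integral>\<^sup>+\<omega>. ennreal_powr (\<Sum>j. d j (X [] \<omega>)) \<beta> \<partial>M) < top"
      by (auto simp: offspring)
  qed

  \<comment> \<open>The absolute values of the summands of \<open>W\<close> are dominated by the generation totals of the iid tree.\<close>
  have finite_sums: "(\<Sum>i\<in>A. ennreal \<bar>if length i = n then Q i \<omega> * path_weight N C i \<omega> else 0\<bar>) \<le> tree.subtree_total n [] \<omega>"
    if "finite A" for A n \<omega>
  proof -
    define B where "B = {i \<in> A. length i = n \<and> i \<in> nodes}"
    define A' where "A' = map (\<lambda>x. x - 1) ` B"
    have B: "B = map Suc ` A'"
    proof -
      have "map Suc (map (\<lambda>x. x - 1) i) = i" if "i \<in> nodes" for i
        using that by (induction i) (auto simp: nodes_def)
      then show ?thesis unfolding A'_def image_image B_def by force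
    qed
    have "(\<Sum>i\<in>A. ennreal \<bar>if length i = n then Q i \<omega> * path_weight N C i \<omega> else 0\<bar>) =
        (\<Sum>i\<in>B. ennreal \<bar>Q i \<omega> * path_weight N C i \<omega>\<bar>)"
      using that by (intro sum.mono_neutral_cong_right) (auto simp: B_def path_weight_not_node)
    also have "\<dots> = (\<Sum>k\<in>A'. ennreal \<bar>Q (map Suc k) \<omega> * path_weight N C (map Suc k) \<omega>\<bar>)"
      unfolding B by (subst sum.reindex) (simp_all add: inj_on_def)
    also have "\<dots> = (\<Sum>k\<in>A'. ennreal \<bar>path_weight N C (map Suc k) \<omega>\<bar> * q (X k \<omega>))"
      unfolding q_X by (intro sum.cong refl) (subst ennreal_mult[symmetric], simp_all add: abs_mult mult.commute)
    also have "\<dots> \<le> generation_total q d n (\<lambda>k. X k \<omega>)"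
      using that
      by (intro sum_weights_le_generation_total)
         (auto simp: path_weight_Nil path_weight_snoc d_X abs_mult ennreal_mult A'_def B_def)
    finally show ?thesis by (simp add: tree.subtree_total_def)
  qed

  define s where "s n \<omega> = enn2real (tree.subtree_total n [] \<omega>)" for n \<omega>
  have total_finite: "tree.subtree_total n [] \<omega> = ennreal (s n \<omega>)" if "T \<omega> < top" for n \<omega>
    using le_less_trans[OF le_suminf_ennreal that[unfolded T_def]] by (simp add: s_def)
  have s_nonneg: "0 \<le> s n \<omega>" for n \<omega> by (simp add: s_def)
  have s_summable: "summable (\<lambda>n. s n \<omega>)" if "T \<omega> < top" for \<omega>
    using that by (intro summable_suminf_not_top s_nonneg)
      (simp add: T_def less_top total_finite[OF that, symmetric])
  have T_eq: "T \<omega> = ennreal (\<Sum>n. s n \<omega>)" if "T \<omega> < top" for \<omega>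
    using s_summable[OF that] by (simp add: T_def total_finite[OF that] suminf_ennreal2 s_nonneg)
  have W_bound: "(\<lambda>i. Q i \<omega> * node_weight C i \<omega>) summable_on generation N n \<omega>" "\<bar>W Q N C n \<omega>\<bar> \<le> s n \<omega>"
    if "T \<omega> < top" for n \<omega>
  proof -
    let ?f = "\<lambda>i. if length i = n then Q i \<omega> * path_weight N C i \<omega> else 0"
    have bound: "(\<Sum>i\<in>A. \<bar>?f i\<bar>) \<le> s n \<omega>" if "finite A" for A
    proof -
      have "ennreal (\<Sum>i\<in>A. \<bar>?f i\<bar>) \<le> ennreal (s n \<omega>)"
        using finite_sums[OF that, of n \<omega>] total_finite[OF \<open>T \<omega> < top\<close>] by (simp add: sum_ennreal)
      then show ?thesis by (subst (asm) ennreal_le_iff) (auto simp: s_def)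
    qed
    show "(\<lambda>i. Q i \<omega> * node_weight C i \<omega>) summable_on generation N n \<omega>"
      unfolding summable_on_generation_iff using bound by (rule abs_infsum_le)
    show "\<bar>W Q N C n \<omega>\<bar> \<le> s n \<omega>"
      unfolding W_eq_infsum_path_weight using bound by (rule abs_infsum_le)
  qed
  have W_summable: "summable (\<lambda>k. \<bar>W Q N C k \<omega>\<bar>)" if "T \<omega> < top" for \<omega>
    using W_bound(2)[OF that] by (intro summable_comparison_test'[OF s_summable[OF that]]) auto
  have W_summable': "summable (\<lambda>k. W Q N C k \<omega>)" if "T \<omega> < top" for \<omega>
    using W_summable[OF that] by (rule summable_rabs_cancel)
  have abs_sum_le: "ennreal \<bar>\<Sum>k. W Q N C (k + m) \<omega>\<bar> \<le> T \<omega>" if "T \<omega> < top" for m \<omega>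
  proof -
    have "\<bar>\<Sum>k. W Q N C (k + m) \<omega>\<bar> \<le> (\<Sum>k. \<bar>W Q N C (k + m) \<omega>\<bar>)"
      using W_summable[OF that] by (intro summable_rabs) (simp add: summable_iff_shift[of "\<lambda>k. \<bar>W Q N C k \<omega>\<bar>"])
    also have "\<dots> \<le> (\<Sum>k. \<bar>W Q N C k \<omega>\<bar>)"
      using suminf_split_initial_segment[OF W_summable[OF that], of m] by (simp add: sum_nonneg)
    also have "\<dots> \<le> (\<Sum>k. s k \<omega>)"
      using W_bound(2)[OF that] W_summable[OF that] s_summable[OF that] by (intro suminf_le)
    finally show ?thesis by (simp add: T_eq[OF that] ennreal_leI)
  qed
  have T_AE: "AE \<omega> in M. T \<omega> < top"
    using nn_integral_noteq_infinite[of "\<lambda>\<omega>. ennreal_powr (T \<omega>) \<beta>" M] T_moment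
    by (simp add: less_top)

  have total_le: "ennreal \<bar>R_total Q N C \<omega>\<bar> \<le> T \<omega>" if "T \<omega> < top" for \<omega>
    using abs_sum_le[OF that, of 0] by (simp add: R_total_def)
  \<comment> \<open>The error of the partial sum is a tail of the series, so it is dominated by \<open>T\<close> as well.\<close>
  have diff_eq: "R_partial Q N C n \<omega> - R_total Q N C \<omega> = - (\<Sum>k. W Q N C (k + Suc n) \<omega>)" if "T \<omega> < top" for n \<omega>
    using suminf_split_initial_segment[OF W_summable'[OF that], of "Suc n"]
    by (simp add: R_partial_def R_total_def lessThan_Suc_atMost)
  have partial_le: "ennreal \<bar>R_partial Q N C n \<omega>\<bar> \<le> T \<omega>" if "T \<omega> < top" for n \<omega>
  proof -
    have "\<bar>R_partial Q N C n \<omega>\<bar> \<le> (\<Sum>k\<le>n. s k \<omega>)"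
      unfolding R_partial_def by (intro order_trans[OF sum_abs] sum_mono W_bound that)
    also have "\<dots> \<le> (\<Sum>k. s k \<omega>)"
      using s_summable[OF that] by (intro sum_le_suminf) (auto simp: s_def)
    finally show ?thesis by (simp add: T_eq[OF that] ennreal_leI)
  qed
  have powr_le: "ennreal (\<bar>x\<bar> powr \<beta>) \<le> ennreal_powr (T \<omega>) \<beta>" if "ennreal \<bar>x\<bar> \<le> T \<omega>" for x \<omega>
    using ennreal_powr_mono[OF that beta_pos] by simp
  have in_Lp: "in_Lp M \<beta> Z" if [measurable]: "Z \<in> borel_measurable M"
    and "\<And>\<omega>. T \<omega> < top \<Longrightarrow> ennreal \<bar>Z \<omega>\<bar> \<le> T \<omega>" for Z
  proof -
    have "(\<integral>\<^sup>+\<omega>. ennreal (\<bar>Z \<omega>\<bar> powr \<beta>) \<partial>M) \<le> (\<integral>\<^sup>+\<omega>. ennreal_powr (T \<omega>) \<beta> \<partial>M)"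
      using T_AE by (intro nn_integral_mono_AE) (auto intro: powr_le that(2))
    with T_moment show ?thesis
      by (auto simp: in_Lp_def Lp_norm_def less_top[symmetric] top_unique that(1))
  qed

  have "AE \<omega> in M. R_well_defined Q N C \<omega>"
    using T_AE by eventually_elim
      (auto simp: R_well_defined_def W_bound intro: W_summable')
  moreover have "integrable M (\<lambda>\<omega>. \<bar>R_total Q N C \<omega>\<bar> powr \<gamma>)" if "0 < \<gamma>" "\<gamma> \<le> \<beta>" for \<gamma>
  proof (rule integrableI_nonneg)
    have "(\<integral>\<^sup>+\<omega>. ennreal (\<bar>R_total Q N C \<omega>\<bar> powr \<gamma>) \<partial>M) \<le> (\<integral>\<^sup>+\<omega>. 1 + ennreal_powr (T \<omega>) \<beta> \<partial>M)"
    proof (rule nn_integral_mono_AE, use T_AE in eventually_elim)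
      fix \<omega> assume "T \<omega> < top"
      have "ennreal (\<bar>R_total Q N C \<omega>\<bar> powr \<gamma>) = ennreal_powr (ennreal \<bar>R_total Q N C \<omega>\<bar>) \<gamma>"
        by simp
      also have "\<dots> \<le> 1 + ennreal_powr (ennreal \<bar>R_total Q N C \<omega>\<bar>) \<beta>"
        using that by (rule ennreal_powr_le_1_plus)
      also have "\<dots> \<le> 1 + ennreal_powr (T \<omega>) \<beta>"
        using total_le[OF \<open>T \<omega> < top\<close>] beta_pos by (intro add_left_mono ennreal_powr_mono)
      finally show "ennreal (\<bar>R_total Q N C \<omega>\<bar> powr \<gamma>) \<le> 1 + ennreal_powr (T \<omega>) \<beta>" .
    qed
    also have "\<dots> < \<infinity>"
      using T_moment by (simp add: nn_integral_add emeasure_space_1)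
    finally show "(\<integral>\<^sup>+\<omega>. ennreal (\<bar>R_total Q N C \<omega>\<bar> powr \<gamma>) \<partial>M) < \<infinity>" .
  qed auto
  moreover have "converges_in_Lp M \<beta> (R_partial Q N C) (R_total Q N C)"
  proof -
    have "(\<lambda>n. \<integral>\<^sup>+\<omega>. ennreal (\<bar>R_partial Q N C n \<omega> - R_total Q N C \<omega>\<bar> powr \<beta>) \<partial>M) \<longlonglongrightarrow> (\<integral>\<^sup>+\<omega>. 0 \<partial>M)"
    proof (rule nn_integral_dominated_convergence[where w = "\<lambda>\<omega>. ennreal_powr (T \<omega>) \<beta>"])
      show "AE \<omega> in M. ennreal (\<bar>R_partial Q N C n \<omega> - R_total Q N C \<omega>\<bar> powr \<beta>) \<le> ennreal_powr (T \<omega>) \<beta>" for n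
        using T_AE
      proof eventually_elim
        fix \<omega> assume "T \<omega> < top"
        then show "ennreal (\<bar>R_partial Q N C n \<omega> - R_total Q N C \<omega>\<bar> powr \<beta>) \<le> ennreal_powr (T \<omega>) \<beta>"
          using abs_sum_le[of \<omega> "Suc n"] by (intro powr_le) (simp only: diff_eq abs_minus_cancel)
      qed
      show "AE \<omega> in M. (\<lambda>n. ennreal (\<bar>R_partial Q N C n \<omega> - R_total Q N C \<omega>\<bar> powr \<beta>)) \<longlonglongrightarrow> 0"
        using T_AE
      proof eventually_elim
        fix \<omega> assume "T \<omega> < top"
        then have "summable (\<lambda>k. W Q N C k \<omega>)"
          by (rule W_summable')
        then have "(\<lambda>n. R_partial Q N C n \<omega>) \<longlonglongrightarrow> R_total Q N C \<omega>"
          unfolding R_partial_def R_total_def by (rule summable_LIMSEQ')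
        then have "(\<lambda>n. \<bar>R_partial Q N C n \<omega> - R_total Q N C \<omega>\<bar>) \<longlonglongrightarrow> 0"
          by (intro tendsto_rabs_zero) (simp add: LIM_zero)
        then have "(\<lambda>n. \<bar>R_partial Q N C n \<omega> - R_total Q N C \<omega>\<bar> powr \<beta>) \<longlonglongrightarrow> 0 powr \<beta>"
          using beta_pos by (intro tendsto_powr') auto
        then show "(\<lambda>n. ennreal (\<bar>R_partial Q N C n \<omega> - R_total Q N C \<omega>\<bar> powr \<beta>)) \<longlonglongrightarrow> 0"
          using tendsto_ennrealI by fastforce
      qed
    qed (use T_moment in auto)
    then have "(\<lambda>n. Lp_norm M \<beta> (\<lambda>\<omega>. R_partial Q N C n \<omega> - R_total Q N C \<omega>)) \<longlonglongrightarrow> 0"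
      unfolding Lp_norm_def using beta_pos by (intro tendsto_ennreal_powr_0) auto
    then show ?thesis
      unfolding converges_in_Lp_def using partial_le total_le by (auto intro!: in_Lp)
  qed
  ultimately show ?thesis by blast
qed

end
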